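(* Let $n \ge 3$ be an integer and let $\mathcal{C}_n(\pi) = (0,\pi)^n \subset \mathbb{R}^n$ be the open hypercube. Then the Extended Courant Property for $\mathcal{C}_n(\pi)$ with the Dirichlet boundary condition on $\partial \mathcal{C}_n(\pi)$ is false; that is, there exist an integer $m \ge 1$ and a linear combination $v$ of Dirichlet eigenfunctions of $-\Delta$ in $\mathcal{C}_n(\pi)$ associated with eigenvalues less than or equal to $\lambda_m$ such that $\beta_0(v) > \kappa(\lambda_m)$.
   Context: Let $\Omega$ be a bounded domain, with a self-adjoint realization of $-\Delta$ given by a homogeneous boundary condition $\mathfrak{b}$ (here $\mathfrak{b}=\mathfrak{d}$, the Dirichlet condition $u|_{\partial\Omega}=0$). Its eigenvalues are listed in nondecreasing order, counted with multiplicity and starting with index $1$: $\lambda_1 < \lambda_2 \le \lambda_3 \le \cdots$. For an eigenvalue $\lambda$, set $\kappa(\lambda) = \min\{k \mid \lambda_k = \lambda\}$. For $\lambda \ge 0$, let $\mathcal{L}(\Omega,\mathfrak{b},\lambda)$ be the real vector space of linear combinations of real eigenfunctions associated with eigenvalues $\le \lambda$. For a real continuous function $v$ on $\Omega$, the nodal set is $\mathcal{Z}(v) = \overline{\{x \in \Omega \mid v(x) = 0\}}$, and $\beta_0(v)$ denotes the number of connected components of $\Omega \setminus \mathcal{Z}(v)$ (nodal domains). The Extended Courant Property $\mathrm{ECP}(\Omega,\mathfrak{b})$ is the assertion: for every $m \ge 1$ and every $v \in \mathcal{L}(\Omega,\mathfrak{b},\lambda_m)$, one has $\beta_0(v) \le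 \kappa(\lambda_m) \le m$. *)

theory Defs
  imports
    "HOL-Analysis.Analysis"
    "HOL-Library.Function_Algebras"
    "HOL-Library.Extended_Nat"
begin

text \<open>Pointwise scalar multiplication, so that the library's \<open>span\<close> and \<open>dim\<close> apply to
  spaces of functions.\<close>

instantiation "fun" :: (type, real_vector) real_vector
begin

definition scaleR_fun :: "real \<Rightarrow> ('a \<Rightarrow> 'b) \<Rightarrow> 'a \<Rightarrow> 'b"
  where "scaleR_fun c f = (\<lambda>x. c *\<^sub>R f x)"

instance
  by standard (auto simp: scaleR_fun_def plus_fun_def fun_eq_iff algebra_simps)

end


definition partial :: "'a::euclidean_space \<Rightarrow> ('a \<Rightarrow> real) \<Rightarrow> 'a \<Rightarrow> real"
  where "partial b u x = frechet_derivative u (at x) b"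

definition C1_on :: "'a::euclidean_space set \<Rightarrow> ('a \<Rightarrow> real) \<Rightarrow> bool"
  where "C1_on \<Omega> u \<longleftrightarrow>
    (\<forall>x\<in>\<Omega>. u differentiable (at x)) \<and> (\<forall>b\<in>Basis. continuous_on \<Omega> (partial b u))"

definition C2_on :: "'a::euclidean_space set \<Rightarrow> ('a \<Rightarrow> real) \<Rightarrow> bool"
  where "C2_on \<Omega> u \<longleftrightarrow> C1_on \<Omega> u \<and> (\<forall>b\<in>Basis. C1_on \<Omega> (partial b u))"

definition laplacian :: "('a::euclidean_space \<Rightarrow> real) \<Rightarrow> 'a \<Rightarrow> real"
  where "laplacian u x = (\<Sum>b\<in>Basis. partial b (partial b u) x)"


text \<open>The Dirichlet condition is membership in the form domain \<open>H\<^sup>1\<^sub>0(\<Omega>)\<close> of the Dirichlet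
  realization of the Laplacian, i.e. in the closure, for the \<open>H\<^sup>1\<close> norm, of the \<open>C\<^sup>1\<close> functions with
  compact support in \<open>\<Omega>\<close>. Eigenfunctions are smooth inside \<open>\<Omega>\<close>, so only \<open>C\<^sup>1\<close> elements are needed;
  their weak gradient is the classical one.\<close>

definition H1_density :: "('a::euclidean_space \<Rightarrow> real) \<Rightarrow> 'a \<Rightarrow> real"
  where "H1_density u x = (u x)\<^sup>2 + (\<Sum>b\<in>Basis. (partial b u x)\<^sup>2)"

definition C1_compact_support :: "'a::euclidean_space set \<Rightarrow> ('a \<Rightarrow> real) set"
  where "C1_compact_support \<Omega> =
    {\<psi>. C1_on UNIV \<psi> \<and> (\<exists>K. compact K \<and> K \<subseteq> \<Omega> \<and> (\<forall>x. x \<notin> K \<longrightarrow> \<psi> x = 0))}"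

definition H10 :: "'a::euclidean_space set \<Rightarrow> ('a \<Rightarrow> real) set"
  where "H10 \<Omega> =
    {u. C1_on \<Omega> u \<and> set_integrable lborel \<Omega> (H1_density u) \<and>
        (\<forall>\<epsilon>>0. \<exists>\<psi>\<in>C1_compact_support \<Omega>.
           (LINT x:\<Omega>|lborel. H1_density (\<lambda>y. u y - \<psi> y) x) < \<epsilon>)}"


text \<open>Functions on \<open>\<Omega>\<close> are represented by total functions vanishing outside \<open>\<Omega>\<close>. This only
  makes the representative unique (as needed for dimensions); the boundary condition is the one
  expressed by \<open>H10\<close>. An \<open>L\<^sup>2\<close> eigenfunction is identified with its \<open>C\<^sup>2\<close> representative, which
  exists by interior regularity.\<close>

definition dirichlet_eigenspace :: "'a::euclidean_space set \<Rightarrow> real \<Rightarrow> ('a \<Rightarrow> real) set"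
  where "dirichlet_eigenspace \<Omega> \<mu> =
    {u. C2_on \<Omega> u \<and> u \<in> H10 \<Omega> \<and> (\<forall>x\<in>\<Omega>. - laplacian u x = \<mu> * u x) \<and>
        (\<forall>x. x \<notin> \<Omega> \<longrightarrow> u x = 0)}"

text \<open>Indices start at 1; the value at 0 is irrelevant. The multiplicity of a real number that is
  not an eigenvalue is 0.\<close>

definition eigenvalue_listing :: "'a::euclidean_space set \<Rightarrow> (nat \<Rightarrow> real) \<Rightarrow> bool"
  where "eigenvalue_listing \<Omega> l \<longleftrightarrow>
    mono_on {1..} l \<and>
    (\<forall>\<mu>. finite {k. 1 \<le> k \<and> l k = \<mu>} \<and>
         card {k. 1 \<le> k \<and> l k = \<mu>} = dim (dirichlet_eigenspace \<Omega> \<mu>))"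

text \<open>For a bounded open set all multiplicities are finite and a listing exists; any listing is
  uniquely determined at the indices \<open>m \<ge> 1\<close>.\<close>

definition dirichlet_eigenvalue :: "'a::euclidean_space set \<Rightarrow> nat \<Rightarrow> real"
  where "dirichlet_eigenvalue \<Omega> = (SOME l. eigenvalue_listing \<Omega> l)"

definition kappa :: "'a::euclidean_space set \<Rightarrow> real \<Rightarrow> nat"
  where "kappa \<Omega> \<mu> = (LEAST k. 1 \<le> k \<and> dirichlet_eigenvalue \<Omega> k = \<mu>)"

definition eigenfunction_combinations :: "'a::euclidean_space set \<Rightarrow> real \<Rightarrow> ('a \<Rightarrow> real) set"
  where "eigenfunction_combinations \<Omega> \<Lambda> = span (\<Union>\<mu>\<in>{..\<Lambda>}. dirichlet_eigenspace \<Omega> \<mu>)"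

definition nodal_set :: "'a::euclidean_space set \<Rightarrow> ('a \<Rightarrow> real) \<Rightarrow> 'a set"
  where "nodal_set \<Omega> v = closure {x \<in> \<Omega>. v x = 0}"

text \<open>Extended natural numbers, because \<open>card\<close> of an infinite set is 0.\<close>

definition nodal_domain_count :: "'a::euclidean_space set \<Rightarrow> ('a \<Rightarrow> real) \<Rightarrow> enat"
  where "nodal_domain_count \<Omega> v =
    (let D = components (\<Omega> - nodal_set \<Omega> v) in if finite D then enat (card D) else \<infinity>)"

definition ECP :: "'a::euclidean_space set \<Rightarrow> bool"
  where "ECP \<Omega> \<longleftrightarrow>
    (\<forall>m\<ge>1. \<forall>v\<in>eigenfunction_combinations \<Omega> (dirichlet_eigenvalue \<Omega> m).
       nodal_domain_count \<Omega> v \<le> enat (kappa \<Omega> (dirichlet_eigenvalue \<Omega> m)) \<and>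
       kappa \<Omega> (dirichlet_eigenvalue \<Omega> m) \<le> m)"

definition hypercube :: "(real ^ 'n) set"
  where "hypercube = {x. \<forall>i. 0 < x $ i \<and> x $ i < pi}"

end

theory Submission
  imports Defs
begin

text \<open>
  The nodal sets of low-energy functions on the cube are quadrics. Put \<open>c\<^sub>i = cos x\<^sub>i\<close>, a homeomorphism
  from the cube to \<open>(-1,1)\<^sup>n\<close>. The ground state \<open>\<phi> = \<Prod>i. sin x\<^sub>i\<close> is positive, and multiplying it by
  \<open>c\<^sub>i\<^sup>2\<close> gives a combination of \<open>\<phi>\<close> and of the eigenfunction in which \<open>sin x\<^sub>i\<close> is replaced by
  \<open>sin 3x\<^sub>i\<close>; the eigenvalues are \<open>n\<close> and \<open>n + 8\<close>. Hence
  \<open>v = \<phi> * (c\<^sub>1\<^sup>2 + \<dots> + c\<^sub>n\<^sup>2 - (n - 1)) = \<phi> * (1 - \<Sum>i. sin\<^sup>2 x\<^sub>i)\<close> is a combination of eigenfunctions of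
  eigenvalue at most \<open>n + 8\<close>. Its zero set is a sphere of radius \<open>sqrt (n - 1)\<close> in the variables \<open>c\<^sub>i\<close>, which
  separates the centre from each of the \<open>2\<^sup>n\<close> corners, and the corners from each other: a path from one
  corner to another must cross some hyperplane \<open>c\<^sub>i = 0\<close>, where the bracket is at most \<open>0\<close>. So \<open>v\<close> has
  at least \<open>2\<^sup>n + 1\<close> nodal domains (\<open>corner_function_nodal_domains\<close>).

  On the other side, the eigenvalues are the sums \<open>\<Sum>i. k\<^sub>i\<^sup>2\<close> with all \<open>k\<^sub>i \<ge> 1\<close>. Such a sum is below
  \<open>n + 8\<close> only if every \<open>k\<^sub>i\<close> is \<open>1\<close> or \<open>2\<close> and at most two of them are \<open>2\<close>, so that
  \<open>\<kappa>(n + 8) \<le> 1 + n + (n choose 2) + 1\<close> (\<open>kappa_hypercube_le\<close>, \<open>card_modes_below\<close>). For \<open>n \<ge> 3\<close> the binomial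
  expansion of \<open>2\<^sup>n\<close> has a further positive term \<open>n choose 3\<close>, whence \<open>\<kappa>(n + 8) < 2\<^sup>n + 1\<close>.

  Most of the work is to determine the Dirichlet spectrum of the cube, without which neither the existence of
  an eigenvalue listing nor the value of an index is known. Eigenfunctions for different eigenvalues are
  orthogonal because \<open>\<integral>\<nabla>u\<cdot>\<nabla>w = \<mu> \<integral>uw\<close> for test functions \<open>w\<close>, and by density for all \<open>w\<close> in
  \<open>H\<^sup>1\<^sub>0\<close> (\<open>eigenfunctions_orthogonal\<close>). The products of sines are eigenfunctions
  (\<open>cube_mode_eigenfunction\<close>), and they are complete (\<open>sine_modes_complete\<close>): their span is a module over the
  polynomials in the \<open>cos x\<^sub>i\<close>, which by Stone and Weierstrass approximate every continuous function on the
  closed cube. Together these facts say that the multiplicity of \<open>\<mu>\<close> is the number of \<open>k\<close> with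
  \<open>\<Sum>i. k\<^sub>i\<^sup>2 = \<mu>\<close> (\<open>dim_dirichlet_eigenspace_hypercube\<close>).
\<close>

section \<open>Calculus with partial derivatives\<close>

lemma partial_eqI: "(u has_derivative D) (at x) \<Longrightarrow> partial b u x = D b"
  unfolding partial_def by (metis frechet_derivative_at)

lemma partial_cong_open:
  assumes "open S" "x \<in> S" "\<And>y. y \<in> S \<Longrightarrow> u y = w y" "u differentiable (at x)"
  shows "partial b w x = partial b u x" "w differentiable (at x)"
proof -
  obtain D where D: "(u has_derivative D) (at x)" using assms(4) by (auto simp: differentiable_def)
  have D': "(w has_derivative D) (at x)"
    by (rule has_derivative_transform_within_open[OF D assms(1,2)]) (use assms(3) in auto)
  show "partial b w x = partial b u x" using partial_eqI[OF D] partial_eqI[OF D'] by simp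
  show "w differentiable (at x)" using D' by (auto simp: differentiable_def)
qed

lemma C1_on_cong:
  assumes "open S" "C1_on S u" "\<And>y. y \<in> S \<Longrightarrow> u y = w y"
  shows "C1_on S w"
proof -
  have d: "\<And>x. x \<in> S \<Longrightarrow> u differentiable (at x)" using assms(2) by (auto simp: C1_on_def)
  have "continuous_on S (partial b w)" if "b \<in> Basis" for b
    using assms(2) that partial_cong_open(1)[OF assms(1) _ assms(3) d]
    by (auto simp: C1_on_def cong: continuous_on_cong)
  then show ?thesis
    using partial_cong_open(2)[OF assms(1) _ assms(3) d] by (auto simp: C1_on_def)
qed

lemma C1_on_subset: "C1_on S u \<Longrightarrow> T \<subseteq> S \<Longrightarrow> C1_on T u"
  by (auto simp: C1_on_def intro: continuous_on_subset)

lemma C1_on_Un: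
  "open S \<Longrightarrow> open T \<Longrightarrow> C1_on S u \<Longrightarrow> C1_on T u \<Longrightarrow> C1_on (S \<union> T) u"
  by (auto simp: C1_on_def intro: continuous_on_open_Un)

lemma C1_on_continuous_on: "C1_on S u \<Longrightarrow> continuous_on S u"
  by (auto simp: C1_on_def intro!: continuous_at_imp_continuous_on differentiable_imp_continuous_within)

lemma has_derivative_frechet:
  "u differentiable (at x) \<Longrightarrow> (u has_derivative (\<lambda>b. partial b u x)) (at x)"
  unfolding partial_def using frechet_derivative_works by auto

lemma partial_diff:
  assumes "u differentiable (at x)" "w differentiable (at x)"
  shows "partial b (\<lambda>y. u y - w y) x = partial b u x - partial b w x"
  using partial_eqI[OF has_derivative_diff[OF assms[THEN has_derivative_frechet]]] by simp

lemma C1_on_diff: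
  assumes "C1_on S u" "C1_on S w"
  shows "C1_on S (\<lambda>y. u y - w y)"
  using assms by (auto simp: C1_on_def partial_diff intro!: continuous_intros cong: continuous_on_cong)

lemma partial_mult:
  assumes "u differentiable (at x)" "w differentiable (at x)"
  shows "partial b (\<lambda>y. u y * w y) x = partial b u x * w x + u x * partial b w x"
  using partial_eqI[OF has_derivative_mult[OF assms[THEN has_derivative_frechet]]] by simp

lemma C1_on_mult:
  assumes "C1_on S u" "C1_on S w"
  shows "C1_on S (\<lambda>y. u y * w y)"
proof -
  note C1_on_continuous_on[OF assms(1)] C1_on_continuous_on[OF assms(2)]
  with assms show ?thesis
    by (auto simp: C1_on_def partial_mult intro!: continuous_intros cong: continuous_on_cong)
qed

lemma partial_eq_0_outside:
  assumes "closed K" "x \<notin> K" "\<And>y. y \<notin> K \<Longrightarrow> u y = (0::real)"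
  shows "partial b u x = 0" "u differentiable (at x)"
  using partial_cong_open[of "-K" x "\<lambda>_. 0" u] assms partial_eqI[OF has_derivative_const]
  by (auto simp: open_Compl)

text \<open>
  Near a point of \<open>\<Omega>\<close> the function is \<open>C\<^sup>1\<close> by assumption, and near any other point it vanishes; the two
  open sets \<open>\<Omega>\<close> and \<open>- K\<close> cover the space.
\<close>

lemma C1_on_UNIV_extend:
  assumes "open \<Omega>" "compact K" "K \<subseteq> \<Omega>" "C1_on \<Omega> u" "\<And>x. x \<notin> K \<Longrightarrow> u x = 0"
  shows "C1_on UNIV u"
proof -
  have K: "closed K" using assms(2) by (rule compact_imp_closed)
  have "C1_on (- K) u"
    using partial_eq_0_outside[OF K _ assms(5)]
    by (auto simp: C1_on_def intro: continuous_on_eq[OF continuous_on_const])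
  then have "C1_on (\<Omega> \<union> - K) u" using assms K by (intro C1_on_Un) auto
  moreover have "\<Omega> \<union> - K = UNIV" using assms(3) by auto
  ultimately show ?thesis by simp
qed

lemma C1_has_real_derivative_line:
  assumes "C1_on UNIV h"
  shows "((\<lambda>t. h (x + t *\<^sub>R b)) has_real_derivative partial b h (x + t *\<^sub>R b)) (at t)"
proof -
  have "h differentiable (at (x + t *\<^sub>R b))" using assms by (auto simp: C1_on_def)
  note d = has_derivative_frechet[OF this]
  have l: "((\<lambda>t. x + t *\<^sub>R b) has_derivative (\<lambda>s. s *\<^sub>R b)) (at t)"
    by (auto intro!: derivative_eq_intros)
  have "((\<lambda>t. h (x + t *\<^sub>R b)) has_derivative (\<lambda>s. partial (s *\<^sub>R b) h (x + t *\<^sub>R b))) (at t)"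
    using diff_chain_at[OF l d] by (simp add: o_def)
  moreover have "(\<lambda>s. partial (s *\<^sub>R b) h (x + t *\<^sub>R b)) = (*) (partial b h (x + t *\<^sub>R b))"
    using linear_cmul[OF has_derivative_linear[OF d]] by (simp add: fun_eq_iff)
  ultimately show ?thesis by (simp add: has_field_derivative_def)
qed

section \<open>Integration by parts against test functions\<close>

lemma integrable_compact_support:
  fixes g :: "'a::euclidean_space \<Rightarrow> real"
  assumes "compact K" "continuous_on K g" "\<And>x. x \<notin> K \<Longrightarrow> g x = 0"
  shows "integrable lborel g"
proof -
  have "indicator K x *\<^sub>R g x = g x" for x using assms(3)[of x] by (cases "x \<in> K") auto
  then have "(\<lambda>x. indicator K x *\<^sub>R g x) = g" by auto
  then show ?thesis using borel_integrable_compact[OF assms(1,2)] by simp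
qed

text \<open>
  Fubini's theorem is avoided by translation invariance: the difference quotients
  \<open>(h (x + t b) - h x) / t\<close> have integral \<open>0\<close> and converge to the partial derivative. The mean value theorem
  bounds them by the maximum of that derivative, on a ball slightly larger than the support.
\<close>

lemma integral_partial_eq_0:
  fixes h :: "'a::euclidean_space \<Rightarrow> real"
  assumes C1: "C1_on UNIV h" and K: "compact K" "\<And>x. x \<notin> K \<Longrightarrow> h x = 0" and b: "b \<in> Basis"
  shows "(LINT x|lborel. partial b h x) = 0"
proof -
  let ?p = "partial b h"
  have cont: "continuous_on UNIV h" "continuous_on UNIV ?p"
    using C1 b C1_on_continuous_on by (auto simp: C1_on_def)
  have p0: "?p x = 0" if "x \<notin> K" for x
    using partial_eq_0_outside(1)[OF compact_imp_closed[OF K(1)] that K(2)] .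
  obtain M where M: "\<And>x. \<bar>?p x\<bar> \<le> M"
  proof -
    have "compact (?p ` K)" using K(1) cont(2) by (intro compact_continuous_image) (auto intro: continuous_on_subset)
    then obtain M where M: "\<And>y. y \<in> ?p ` K \<Longrightarrow> \<bar>y\<bar> \<le> M"
      by (metis compact_imp_bounded bounded_iff real_norm_def)
    have "\<bar>?p x\<bar> \<le> \<bar>M\<bar>" for x using p0[of x] M[of "?p x"] by (cases "x \<in> K") auto
    then show ?thesis using that by blast
  qed
  obtain R where R: "\<And>x. x \<in> K \<Longrightarrow> norm x \<le> R" using compact_imp_bounded[OF K(1)] by (auto simp: bounded_iff)
  define t where "t m = inverse (real (Suc m))" for m
  have t: "0 < t m" "t m \<le> 1" for m by (auto simp: t_def field_simps)
  have t0: "t \<longlonglongrightarrow> 0" unfolding t_def by (rule LIMSEQ_inverse_real_of_nat)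
  define D where "D m x = (h (x + t m *\<^sub>R b) - h x) / t m" for m x
  define B where "B x = indicator (cball 0 (R+1)) x *\<^sub>R M" for x :: 'a
  have hint: "integrable lborel h" by (rule integrable_compact_support[OF K(1) continuous_on_subset[OF cont(1)] K(2)]) auto
  have shift: "integrable lborel (\<lambda>x. h (x + c))" "(LINT x|lborel. h (x + c)) = (LINT x|lborel. h x)" for c
  proof -
    have eq: "lborel = distr lborel borel ((+) c)" by (simp add: lborel_distr_plus)
    have hm: "h \<in> borel_measurable borel" using cont(1) by (rule borel_measurable_continuous_onI)
    have "integrable (distr lborel borel ((+) c)) h" using hint eq by simp
    then show "integrable lborel (\<lambda>x. h (x + c))" using hm
      by (subst (asm) integrable_distr_eq) (auto simp: add.commute)
    have "(LINT x|lborel. h x) = (LINT x|distr lborel borel ((+) c). h x)" using eq by simp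
    also have "\<dots> = (LINT x|lborel. h (x + c))" using hm by (subst integral_distr) (auto simp: add.commute)
    finally show "(LINT x|lborel. h (x + c)) = (LINT x|lborel. h x)" by simp
  qed
  have D0: "(LINT x|lborel. D m x) = 0" for m
    unfolding D_def using shift hint by simp
  have Dint: "integrable lborel (D m)" for m unfolding D_def using shift hint by simp
  have lim: "(\<lambda>m. D m x) \<longlonglongrightarrow> ?p x" for x
  proof -
    have "((\<lambda>s. (h (x + s *\<^sub>R b) - h x) / s) \<longlongrightarrow> ?p x) (at 0)"
      using C1_has_real_derivative_line[OF C1, of x b 0] by (simp add: has_field_derivative_iff)
    moreover have "filterlim t (at 0) sequentially"
      using t0 t(1) by (auto simp: filterlim_at less_imp_neq[THEN not_sym])
    ultimately show ?thesis unfolding D_def by (rule filterlim_compose)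
  qed
  have bound: "norm (D m x) \<le> B x" for m x
  proof -
    have "\<exists>z>0. z < t m \<and> h (x + t m *\<^sub>R b) - h (x + 0 *\<^sub>R b) = (t m - 0) * ?p (x + z *\<^sub>R b)"
      by (rule MVT2) (use t C1_has_real_derivative_line[OF C1] in auto)
    then obtain z where z: "h (x + t m *\<^sub>R b) - h x = t m * ?p (x + z *\<^sub>R b)" by auto
    then have "D m x = ?p (x + z *\<^sub>R b)" using t(1)[of m] by (simp add: D_def)
    then have 1: "\<bar>D m x\<bar> \<le> M" using M by simp
    show ?thesis
    proof (cases "x \<in> cball 0 (R+1)")
      case False
      have "norm x \<le> norm (x + t m *\<^sub>R b) + norm (t m *\<^sub>R b)"
        by (metis add_diff_cancel_right' norm_triangle_ineq4)
      also have "norm (t m *\<^sub>R b) \<le> 1" using t b by (simp add: less_imp_le)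
      finally have "x + t m *\<^sub>R b \<notin> K" "x \<notin> K" using False R by force+
      then show ?thesis using K(2) False by (simp add: D_def B_def)
    qed (use 1 in \<open>simp add: B_def\<close>)
  qed
  have "(\<lambda>m. LINT x|lborel. D m x) \<longlonglongrightarrow> (LINT x|lborel. ?p x)"
  proof (rule integral_dominated_convergence)
    show "integrable lborel B" unfolding B_def by (rule borel_integrable_compact) auto
    show "?p \<in> borel_measurable lborel" using cont(2) by (simp add: borel_measurable_continuous_onI)
  qed (use Dint lim bound in auto)
  then show ?thesis using D0 by (simp add: LIMSEQ_const_iff)
qed

lemma set_integrable_compact_support:
  fixes g :: "'a::euclidean_space \<Rightarrow> real"
  assumes "continuous_on \<Omega> g" "compact K" "K \<subseteq> \<Omega>" "\<And>x. x \<notin> K \<Longrightarrow> g x = 0"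
  shows "set_integrable lborel \<Omega> g"
proof -
  have "continuous_on K (\<lambda>x. indicator \<Omega> x *\<^sub>R g x)"
    by (rule continuous_on_eq[OF continuous_on_subset[OF assms(1,3)]]) (use assms(3) in auto)
  from integrable_compact_support[OF assms(2) this] show ?thesis
    using assms(4) by (simp add: set_integrable_def)
qed

text \<open>
  The product \<open>f \<psi>\<close>, extended by \<open>0\<close> outside \<open>\<Omega>\<close>, is a compactly supported \<open>C\<^sup>1\<close> function on the
  whole space, whatever \<open>f\<close> does at the boundary of \<open>\<Omega>\<close>; the product rule does the rest.
\<close>

lemma set_integral_by_parts:
  assumes \<Omega>: "open \<Omega>" and f: "C1_on \<Omega> f" and \<psi>: "\<psi> \<in> C1_compact_support \<Omega>" and b: "b \<in> Basis"
  shows "set_integrable lborel \<Omega> (\<lambda>x. partial b f x * \<psi> x)"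
    and "set_integrable lborel \<Omega> (\<lambda>x. f x * partial b \<psi> x)"
    and "(LINT x:\<Omega>|lborel. f x * partial b \<psi> x) = - (LINT x:\<Omega>|lborel. partial b f x * \<psi> x)"
proof -
  obtain K where K: "compact K" "K \<subseteq> \<Omega>" "\<And>x. x \<notin> K \<Longrightarrow> \<psi> x = 0" and C: "C1_on UNIV \<psi>"
    using \<psi> by (auto simp: C1_compact_support_def)
  have C\<Omega>: "C1_on \<Omega> \<psi>" using C1_on_subset[OF C] by simp
  have p0: "partial b \<psi> x = 0" if "x \<notin> K" for x
    using partial_eq_0_outside(1)[OF compact_imp_closed[OF K(1)] that K(3)] .
  note c = C1_on_continuous_on[OF f] C1_on_continuous_on[OF C\<Omega>]
  have c': "continuous_on \<Omega> (partial b f)" "continuous_on \<Omega> (partial b \<psi>)"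
    using f C\<Omega> b by (auto simp: C1_on_def)
  show 1: "set_integrable lborel \<Omega> (\<lambda>x. partial b f x * \<psi> x)"
    by (rule set_integrable_compact_support[OF _ K(1,2)]) (use c c' K(3) in \<open>auto intro!: continuous_intros\<close>)
  show 2: "set_integrable lborel \<Omega> (\<lambda>x. f x * partial b \<psi> x)"
    by (rule set_integrable_compact_support[OF _ K(1,2)]) (use c c' p0 in \<open>auto intro!: continuous_intros\<close>)
  define h where "h x = (if x \<in> \<Omega> then f x * \<psi> x else 0)" for x
  have h0: "\<And>x. x \<notin> K \<Longrightarrow> h x = 0" using K by (auto simp: h_def)
  have "C1_on \<Omega> h" by (rule C1_on_cong[OF \<Omega> C1_on_mult[OF f C\<Omega>]]) (auto simp: h_def)
  then have hC: "C1_on UNIV h" by (rule C1_on_UNIV_extend[OF \<Omega> K(1,2)]) (rule h0)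
  have ph: "partial b h x = indicator \<Omega> x *\<^sub>R (partial b f x * \<psi> x + f x * partial b \<psi> x)" for x
  proof (cases "x \<in> \<Omega>")
    case True
    then have d: "f differentiable (at x)" "\<psi> differentiable (at x)" using f C\<Omega> by (auto simp: C1_on_def)
    have "partial b h x = partial b (\<lambda>y. f y * \<psi> y) x"
      by (rule partial_cong_open(1)[OF \<Omega> True]) (use d in \<open>auto simp: h_def\<close>)
    then show ?thesis using True d by (simp add: partial_mult)
  next
    case False
    then have "x \<notin> K" using K by auto
    then show ?thesis using partial_eq_0_outside(1)[OF compact_imp_closed[OF K(1)] _ h0] False by simp
  qed
  have "(LINT x|lborel. partial b h x) = 0" by (rule integral_partial_eq_0[OF hC K(1) h0 b])
  then have "(LINT x:\<Omega>|lborel. partial b f x * \<psi> x + f x * partial b \<psi> x) = 0"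
    by (simp add: ph set_lebesgue_integral_def)
  then show "(LINT x:\<Omega>|lborel. f x * partial b \<psi> x) = - (LINT x:\<Omega>|lborel. partial b f x * \<psi> x)"
    using set_integral_add(2)[OF 1 2] by simp
qed

section \<open>Energy forms and orthogonality of eigenfunctions\<close>

text \<open>
  Continuity on an open set stands in for measurability in all the integrability arguments below.
\<close>

lemma set_integrable_continuous_bound:
  fixes f g :: "'a::euclidean_space \<Rightarrow> real"
  assumes "open \<Omega>" "continuous_on \<Omega> g" "set_integrable lborel \<Omega> f"
    and "\<And>x. x \<in> \<Omega> \<Longrightarrow> \<bar>g x\<bar> \<le> f x"
  shows "set_integrable lborel \<Omega> g"
proof (rule set_integrable_bound[OF assms(3)])
  show "set_borel_measurable lborel \<Omega> g"
    using borel_measurable_continuous_on_indicator[OF _ assms(2)] assms(1)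
    by (simp add: set_borel_measurable_def)
  show "AE x in lborel. x \<in> \<Omega> \<longrightarrow> norm (g x) \<le> norm (f x)"
    using assms(4) by (intro always_eventually) force
qed

lemma set_integrable_sum:
  fixes f :: "'i \<Rightarrow> 'a \<Rightarrow> real"
  assumes "\<And>i. i \<in> I \<Longrightarrow> set_integrable M A (f i)"
  shows "set_integrable M A (\<lambda>x. \<Sum>i\<in>I. f i x)"
  using assms Bochner_Integration.integrable_sum[of I M "\<lambda>i x. indicator A x *\<^sub>R f i x"]
  by (simp add: set_integrable_def sum_distrib_left)

lemma set_integral_sum:
  fixes f :: "'i \<Rightarrow> 'a \<Rightarrow> real"
  assumes "\<And>i. i \<in> I \<Longrightarrow> set_integrable M A (f i)"
  shows "(LINT x:A|M. \<Sum>i\<in>I. f i x) = (\<Sum>i\<in>I. LINT x:A|M. f i x)"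
  using assms
  by (simp add: set_lebesgue_integral_def set_integrable_def sum_distrib_left Bochner_Integration.integral_sum)

lemma H1_density_nonneg: "0 \<le> H1_density u x"
  by (simp add: H1_density_def sum_nonneg)

lemma square_le_H1_density: "(u x)\<^sup>2 \<le> H1_density u x"
  by (simp add: H1_density_def sum_nonneg)

lemma continuous_on_H1_density: "C1_on \<Omega> u \<Longrightarrow> continuous_on \<Omega> (H1_density u)"
  unfolding H1_density_def using C1_on_continuous_on[of \<Omega> u]
  by (auto simp: C1_on_def intro!: continuous_intros)

lemma H1_density_diff_le:
  assumes "u differentiable (at x)" "w differentiable (at x)"
  shows "H1_density (\<lambda>y. u y - w y) x \<le> 2 * H1_density u x + 2 * H1_density w x"
proof -
  have sq: "(a - b)\<^sup>2 \<le> 2 * a\<^sup>2 + 2 * b\<^sup>2" for a b :: real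
    using zero_le_power2[of "a + b"] by (simp add: power2_eq_square algebra_simps)
  have "(\<Sum>b\<in>Basis. (partial b u x - partial b w x)\<^sup>2)
      \<le> (\<Sum>b\<in>Basis. 2 * (partial b u x)\<^sup>2 + 2 * (partial b w x)\<^sup>2)"
    by (intro sum_mono sq)
  also have "\<dots> = 2 * (\<Sum>b\<in>Basis. (partial b u x)\<^sup>2) + 2 * (\<Sum>b\<in>Basis. (partial b w x)\<^sup>2)"
    by (simp add: sum.distrib sum_distrib_left)
  finally show ?thesis
    using sq[of "u x" "w x"] by (simp add: H1_density_def partial_diff[OF assms])
qed

lemma H10_integrable:
  assumes "u \<in> H10 \<Omega>"
  shows "C1_on \<Omega> u" "set_integrable lborel \<Omega> (H1_density u)"
  using assms by (auto simp: H10_def)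

lemma C1_compact_support_integrable:
  assumes "\<psi> \<in> C1_compact_support \<Omega>"
  shows "C1_on \<Omega> \<psi>" "set_integrable lborel \<Omega> (H1_density \<psi>)"
proof -
  obtain K where K: "compact K" "K \<subseteq> \<Omega>" "\<And>x. x \<notin> K \<Longrightarrow> \<psi> x = 0" and C: "C1_on UNIV \<psi>"
    using assms by (auto simp: C1_compact_support_def)
  show "C1_on \<Omega> \<psi>" using C1_on_subset[OF C] by simp
  then show "set_integrable lborel \<Omega> (H1_density \<psi>)"
    using K partial_eq_0_outside(1)[OF compact_imp_closed[OF K(1)] _ K(3)]
    by (intro set_integrable_compact_support[OF _ K(1,2)] continuous_on_H1_density)
       (auto simp: H1_density_def)
qed

lemma H1_density_diff_integrable:
  assumes "open \<Omega>" "C1_on \<Omega> u" "set_integrable lborel \<Omega> (H1_density u)"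
    "C1_on \<Omega> w" "set_integrable lborel \<Omega> (H1_density w)"
  shows "set_integrable lborel \<Omega> (H1_density (\<lambda>y. u y - w y))"
proof (rule set_integrable_continuous_bound[OF assms(1)])
  show "continuous_on \<Omega> (H1_density (\<lambda>y. u y - w y))"
    by (intro continuous_on_H1_density C1_on_diff assms)
  show "set_integrable lborel \<Omega> (\<lambda>x. 2 * H1_density u x + 2 * H1_density w x)"
    using assms by (intro set_integral_add set_integrable_mult_right) auto
  show "\<bar>H1_density (\<lambda>y. u y - w y) x\<bar> \<le> 2 * H1_density u x + 2 * H1_density w x" if "x \<in> \<Omega>" for x
    using H1_density_diff_le[of u x w] assms(2,4) that H1_density_nonneg[of "\<lambda>y. u y - w y" x]
    by (simp add: C1_on_def)
qed

text \<open>
  The set \<open>S\<close> selects directions. With \<open>S = Basis\<close> this is the weak form of \<open>- \<Delta>u = \<mu> u\<close>. A single direction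
  expresses that \<open>u\<close> is an eigenfunction of one second derivative \<open>\<partial>\<^sub>i\<^sup>2\<close>; that version distinguishes product
  eigenfunctions which share the same eigenvalue of the Laplacian.
\<close>

definition energy_form :: "'a::euclidean_space set \<Rightarrow> real \<Rightarrow> ('a \<Rightarrow> real) \<Rightarrow> ('a \<Rightarrow> real) \<Rightarrow> 'a \<Rightarrow> real"
  where "energy_form S \<mu> u w x = (\<Sum>b\<in>S. partial b u x * partial b w x) - \<mu> * (u x * w x)"

text \<open>
  The elementary inequality \<open>2 \<bar>a c\<bar> \<le> t a\<^sup>2 + c\<^sup>2 / t\<close>, with a parameter \<open>t\<close> left free, does the service of the
  Cauchy--Schwarz inequality: a small second factor is exploited by taking \<open>t\<close> small.
\<close>

lemma energy_form_le:
  assumes "S \<subseteq> Basis" "0 < t"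
  shows "\<bar>energy_form S \<mu> u w x\<bar> \<le> (1 + \<bar>\<mu>\<bar>) / 2 * (t * H1_density u x + H1_density w x / t)"
proof -
  have young: "\<bar>a * c\<bar> \<le> (t * a\<^sup>2 + c\<^sup>2 / t) / 2" for a c
  proof -
    have "0 \<le> (t * \<bar>a\<bar> - \<bar>c\<bar>)\<^sup>2 / t" using assms(2) by simp
    also have "\<dots> = t * a\<^sup>2 + c\<^sup>2 / t - 2 * \<bar>a * c\<bar>"
      using assms(2) by (simp add: power2_eq_square abs_mult field_simps)
    finally show ?thesis by simp
  qed
  have "\<bar>\<Sum>b\<in>S. partial b u x * partial b w x\<bar> \<le> (\<Sum>b\<in>S. \<bar>partial b u x * partial b w x\<bar>)" by (rule sum_abs)
  also have "\<dots> \<le> (\<Sum>b\<in>Basis. \<bar>partial b u x * partial b w x\<bar>)" using assms(1) by (intro sum_mono2) auto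
  also have "\<dots> \<le> (\<Sum>b\<in>Basis. (t * (partial b u x)\<^sup>2 + (partial b w x)\<^sup>2 / t) / 2)" by (intro sum_mono young)
  also have "\<dots> = (t * (\<Sum>b\<in>Basis. (partial b u x)\<^sup>2) + (\<Sum>b\<in>Basis. (partial b w x)\<^sup>2) / t) / 2"
    by (simp add: sum.distrib sum_distrib_left sum_divide_distrib add_divide_distrib)
  also have "\<dots> \<le> (t * H1_density u x + H1_density w x / t) / 2"
    using assms(2) by (intro divide_right_mono add_mono mult_left_mono) (auto simp: H1_density_def)
  finally have 1: "\<bar>\<Sum>b\<in>S. partial b u x * partial b w x\<bar> \<le> (t * H1_density u x + H1_density w x / t) / 2" .
  have "\<bar>u x * w x\<bar> \<le> (t * (u x)\<^sup>2 + (w x)\<^sup>2 / t) / 2" by (rule young)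
  also have "\<dots> \<le> (t * H1_density u x + H1_density w x / t) / 2"
    using assms(2) by (intro divide_right_mono add_mono mult_left_mono square_le_H1_density) auto
  finally have "\<bar>\<mu>\<bar> * \<bar>u x * w x\<bar> \<le> \<bar>\<mu>\<bar> * ((t * H1_density u x + H1_density w x / t) / 2)"
    by (intro mult_left_mono) auto
  then have "\<bar>\<mu> * (u x * w x)\<bar> \<le> \<bar>\<mu>\<bar> * ((t * H1_density u x + H1_density w x / t) / 2)"
    by (simp add: abs_mult)
  with 1 show ?thesis unfolding energy_form_def by (simp add: algebra_simps add_divide_distrib)
qed

lemma energy_form_integrable:
  assumes "open \<Omega>" "S \<subseteq> Basis" "C1_on \<Omega> u" "set_integrable lborel \<Omega> (H1_density u)"
    "C1_on \<Omega> w" "set_integrable lborel \<Omega> (H1_density w)"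
  shows "set_integrable lborel \<Omega> (energy_form S \<mu> u w)"
proof (rule set_integrable_continuous_bound[OF assms(1)])
  show "continuous_on \<Omega> (energy_form S \<mu> u w)"
    unfolding energy_form_def using assms(2,3,5) C1_on_continuous_on[of \<Omega> u] C1_on_continuous_on[of \<Omega> w]
    by (auto simp: C1_on_def intro!: continuous_intros)
  show "set_integrable lborel \<Omega> (\<lambda>x. (1 + \<bar>\<mu>\<bar>) / 2 * (1 * H1_density u x + H1_density w x / 1))"
    using assms by (auto intro!: set_integral_add set_integrable_mult_right)
qed (rule energy_form_le[OF assms(2)], simp)

text \<open>
  Each term \<open>\<partial>\<^sub>b u \<partial>\<^sub>b \<psi>\<close> is integrated by parts, and the second derivatives of \<open>u\<close> are summed with the
  differential equation.
\<close>

lemma energy_form_test_function: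
  assumes \<Omega>: "open \<Omega>" and S: "S \<subseteq> Basis" and u: "C2_on \<Omega> u"
    and eq: "\<And>x. x \<in> \<Omega> \<Longrightarrow> - (\<Sum>b\<in>S. partial b (partial b u) x) = \<mu> * u x"
    and \<psi>: "\<psi> \<in> C1_compact_support \<Omega>"
  shows "(LINT x:\<Omega>|lborel. energy_form S \<mu> u \<psi> x) = 0"
proof -
  have C1: "C1_on \<Omega> (partial b u)" if "b \<in> S" for b using u S that by (auto simp: C2_on_def)
  note ibp = set_integral_by_parts[OF \<Omega> C1 \<psi>]
  have bB: "b \<in> Basis" if "b \<in> S" for b using S that by auto
  have int1: "set_integrable lborel \<Omega> (\<lambda>x. partial b u x * partial b \<psi> x)" if "b \<in> S" for b
    using ibp(2)[OF that bB[OF that]] .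
  have int2: "set_integrable lborel \<Omega> (\<lambda>x. partial b (partial b u) x * \<psi> x)" if "b \<in> S" for b
    using ibp(1)[OF that bB[OF that]] .
  have e: "(\<Sum>b\<in>S. partial b (partial b u) x * \<psi> x) = - (\<mu> * (u x * \<psi> x))" if "x \<in> \<Omega>" for x
    using arg_cong[OF eq[OF that], of "\<lambda>r. - r * \<psi> x"] by (simp add: sum_distrib_right)
  have "set_integrable lborel \<Omega> (\<lambda>x. \<Sum>b\<in>S. partial b (partial b u) x * \<psi> x)"
    by (rule set_integrable_sum[OF int2])
  then have int3: "set_integrable lborel \<Omega> (\<lambda>x. \<mu> * (u x * \<psi> x))"
    using set_integrable_cong[of lborel lborel \<Omega> \<Omega> _ "\<lambda>x. - (\<mu> * (u x * \<psi> x))", OF refl refl e]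
    by (simp add: set_integrable_def)
  have "(LINT x:\<Omega>|lborel. energy_form S \<mu> u \<psi> x)
      = (LINT x:\<Omega>|lborel. \<Sum>b\<in>S. partial b u x * partial b \<psi> x) - (LINT x:\<Omega>|lborel. \<mu> * (u x * \<psi> x))"
    unfolding energy_form_def by (intro set_integral_diff int3 set_integrable_sum[OF int1])
  also have "(LINT x:\<Omega>|lborel. \<Sum>b\<in>S. partial b u x * partial b \<psi> x)
      = (\<Sum>b\<in>S. LINT x:\<Omega>|lborel. partial b u x * partial b \<psi> x)"
    by (rule set_integral_sum[OF int1])
  also have "\<dots> = - (\<Sum>b\<in>S. LINT x:\<Omega>|lborel. partial b (partial b u) x * \<psi> x)"
    using ibp(3) bB by (simp add: sum_negf)
  also have "(\<Sum>b\<in>S. LINT x:\<Omega>|lborel. partial b (partial b u) x * \<psi> x)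
      = (LINT x:\<Omega>|lborel. \<Sum>b\<in>S. partial b (partial b u) x * \<psi> x)"
    by (rule set_integral_sum[OF int2, symmetric])
  also have "\<dots> = (LINT x:\<Omega>|lborel. - (\<mu> * (u x * \<psi> x)))"
    using e \<Omega> by (intro set_lebesgue_integral_cong) auto
  also have "\<dots> = - (LINT x:\<Omega>|lborel. \<mu> * (u x * \<psi> x))"
    unfolding set_lebesgue_integral_def scaleR_minus_right by (rule Bochner_Integration.integral_minus)
  finally show ?thesis by simp
qed

text \<open>
  The weak form extends from test functions to \<open>H\<^sup>1\<^sub>0\<close>: if \<open>\<psi>\<close> approximates \<open>w\<close> up to \<open>t\<^sup>2\<close> in the squared norm, the
  bound of \<open>energy_form_le\<close> with the same \<open>t\<close> makes the error a multiple of \<open>t\<close>.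
\<close>

lemma energy_form_H10:
  assumes \<Omega>: "open \<Omega>" and S: "S \<subseteq> Basis" and u: "C2_on \<Omega> u" "set_integrable lborel \<Omega> (H1_density u)"
    and eq: "\<And>x. x \<in> \<Omega> \<Longrightarrow> - (\<Sum>b\<in>S. partial b (partial b u) x) = \<mu> * u x"
    and w: "w \<in> H10 \<Omega>"
  shows "(LINT x:\<Omega>|lborel. energy_form S \<mu> u w x) = 0"
proof -
  have Cu: "C1_on \<Omega> u" using u by (simp add: C2_on_def)
  define I where "I = (LINT x:\<Omega>|lborel. H1_density u x)"
  have I: "0 \<le> I" unfolding I_def set_lebesgue_integral_def
    by (intro integral_nonneg_AE) (auto simp: H1_density_nonneg)
  let ?J = "LINT x:\<Omega>|lborel. energy_form S \<mu> u w x"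
  have bd: "\<bar>?J\<bar> \<le> (1 + \<bar>\<mu>\<bar>) / 2 * (I + 1) * t" if t: "0 < t" for t
  proof -
    \<comment> \<open>The accuracy \<open>t\<^sup>2\<close> survives the division by \<open>t\<close> in the bound on the energy form.\<close>
    obtain \<psi> where \<psi>: "\<psi> \<in> C1_compact_support \<Omega>"
      and small: "(LINT x:\<Omega>|lborel. H1_density (\<lambda>y. w y - \<psi> y) x) < t\<^sup>2"
      using w t unfolding H10_def by (auto dest: spec[of _ "t\<^sup>2"])
    note \<psi>C = C1_compact_support_integrable[OF \<psi>] and wC = H10_integrable[OF w]
    have dC: "C1_on \<Omega> (\<lambda>y. w y - \<psi> y)" by (intro C1_on_diff \<psi>C wC)
    have dI: "set_integrable lborel \<Omega> (H1_density (\<lambda>y. w y - \<psi> y))"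
      by (intro H1_density_diff_integrable \<Omega> \<psi>C wC)
    have split: "energy_form S \<mu> u w x = energy_form S \<mu> u \<psi> x + energy_form S \<mu> u (\<lambda>y. w y - \<psi> y) x"
      if "x \<in> \<Omega>" for x
      using wC(1) \<psi>C(1) that
      by (simp add: energy_form_def C1_on_def partial_diff sum.distrib[symmetric] algebra_simps)
    have "?J = (LINT x:\<Omega>|lborel. energy_form S \<mu> u \<psi> x + energy_form S \<mu> u (\<lambda>y. w y - \<psi> y) x)"
      using split \<Omega> by (intro set_lebesgue_integral_cong) auto
    also have "\<dots> = (LINT x:\<Omega>|lborel. energy_form S \<mu> u (\<lambda>y. w y - \<psi> y) x)"
      using energy_form_integrable[OF \<Omega> S Cu u(2) \<psi>C] energy_form_integrable[OF \<Omega> S Cu u(2) dC dI]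
        energy_form_test_function[OF \<Omega> S u(1) eq \<psi>] by (simp add: set_integral_add)
    finally have J: "?J = (LINT x:\<Omega>|lborel. energy_form S \<mu> u (\<lambda>y. w y - \<psi> y) x)" .
    let ?B = "\<lambda>x. (1 + \<bar>\<mu>\<bar>) / 2 * (t * H1_density u x + H1_density (\<lambda>y. w y - \<psi> y) x / t)"
    have Bint: "set_integrable lborel \<Omega> ?B"
      using u(2) dI by (intro set_integrable_mult_right set_integral_add) auto
    have "\<bar>?J\<bar> \<le> (LINT x:\<Omega>|lborel. \<bar>energy_form S \<mu> u (\<lambda>y. w y - \<psi> y) x\<bar>)"
      using integral_norm_bound[of lborel "\<lambda>x. indicator \<Omega> x *\<^sub>R energy_form S \<mu> u (\<lambda>y. w y - \<psi> y) x"]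
      unfolding J by (simp add: set_lebesgue_integral_def abs_mult)
    also have "\<dots> \<le> (LINT x:\<Omega>|lborel. ?B x)"
      by (rule set_integral_mono[OF set_integrable_abs[OF energy_form_integrable[OF \<Omega> S Cu u(2) dC dI]] Bint])
         (rule energy_form_le[OF S t])
    also have "\<dots> = (1 + \<bar>\<mu>\<bar>) / 2 * (t * I + (LINT x:\<Omega>|lborel. H1_density (\<lambda>y. w y - \<psi> y) x) / t)"
      using u(2) dI unfolding I_def
      by (subst set_integral_mult_right, subst set_integral_add(2)) auto
    also have "\<dots> \<le> (1 + \<bar>\<mu>\<bar>) / 2 * (t * I + t)"
      using small t by (intro mult_left_mono add_left_mono) (auto simp: field_simps power2_eq_square)
    finally show ?thesis by (simp add: algebra_simps)
  qed
  have "\<bar>?J\<bar> \<le> 0"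
  proof (rule field_le_epsilon)
    fix e :: real assume e: "0 < e"
    define c where "c = (1 + \<bar>\<mu>\<bar>) / 2 * (I + 1)"
    have c: "0 < c" unfolding c_def using I by (intro mult_pos_pos) auto
    have "\<bar>?J\<bar> \<le> c * (e / c)" unfolding c_def using c e by (intro bd) (simp add: c_def)
    then show "\<bar>?J\<bar> \<le> 0 + e" using c by simp
  qed
  then show ?thesis by simp
qed

text \<open>
  The product is the energy form for the empty set of directions and \<open>\<mu> = -1\<close>.
\<close>

lemma product_integrable:
  assumes "open \<Omega>" "u \<in> H10 \<Omega>" "w \<in> H10 \<Omega>"
  shows "set_integrable lborel \<Omega> (\<lambda>x. u x * w x)"
  using energy_form_integrable[of \<Omega> "{}" u w "-1"] H10_integrable[OF assms(2)] H10_integrable[OF assms(3)] assms(1)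
  by (simp add: energy_form_def[abs_def])

text \<open>
  The Dirichlet integral over the directions in \<open>S\<close> is symmetric, so it equals both \<open>\<mu> \<integral>uw\<close> and
  \<open>\<nu> \<integral>uw\<close>.
\<close>

lemma eigenfunctions_orthogonal:
  assumes \<Omega>: "open \<Omega>" and S: "S \<subseteq> Basis"
    and u: "C2_on \<Omega> u" "u \<in> H10 \<Omega>" "\<And>x. x \<in> \<Omega> \<Longrightarrow> - (\<Sum>b\<in>S. partial b (partial b u) x) = \<mu> * u x"
    and w: "C2_on \<Omega> w" "w \<in> H10 \<Omega>" "\<And>x. x \<in> \<Omega> \<Longrightarrow> - (\<Sum>b\<in>S. partial b (partial b w) x) = \<nu> * w x"
    and ne: "\<mu> \<noteq> \<nu>"
  shows "(LINT x:\<Omega>|lborel. u x * w x) = 0"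
proof -
  note uC = H10_integrable[OF u(2)] and wC = H10_integrable[OF w(2)]
  have 1: "(LINT x:\<Omega>|lborel. energy_form S \<mu> u w x) = 0" by (rule energy_form_H10[OF \<Omega> S u(1) uC(2) u(3) w(2)])
  have 2: "(LINT x:\<Omega>|lborel. energy_form S \<nu> w u x) = 0" by (rule energy_form_H10[OF \<Omega> S w(1) wC(2) w(3) u(2)])
  have "(LINT x:\<Omega>|lborel. (\<mu> - \<nu>) * (u x * w x)) = (LINT x:\<Omega>|lborel. energy_form S \<nu> w u x - energy_form S \<mu> u w x)"
    by (intro arg_cong[where f="set_lebesgue_integral lborel \<Omega>"] ext) (simp add: energy_form_def algebra_simps)
  also have "\<dots> = 0" using 1 2 energy_form_integrable[OF \<Omega> S uC wC] energy_form_integrable[OF \<Omega> S wC uC]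
    by (simp add: set_integral_diff)
  finally show ?thesis using ne by simp
qed

section \<open>Functions vanishing on the boundary lie in the form domain\<close>

text \<open>
  The set where \<open>f\<close> differs from \<open>0\<close> is open and of measure zero, hence empty.
\<close>

lemma set_integral_eq_0_imp_eq_0:
  fixes f :: "'a::euclidean_space \<Rightarrow> real"
  assumes \<Omega>: "open \<Omega>" and f: "continuous_on \<Omega> f" "set_integrable lborel \<Omega> f"
    and nonneg: "\<And>x. x \<in> \<Omega> \<Longrightarrow> 0 \<le> f x" and zero: "(LINT x:\<Omega>|lborel. f x) = 0" and x: "x \<in> \<Omega>"
  shows "f x = 0"
proof -
  let ?U = "\<Omega> \<inter> f -` (- {0})"
  have U: "open ?U" using f(1) unfolding continuous_on_open_vimage[OF \<Omega>] by (simp add: Int_commute open_Compl)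
  have "AE x in lborel. indicator \<Omega> x *\<^sub>R f x = 0"
    using integral_nonneg_eq_0_iff_AE[of lborel "\<lambda>x. indicator \<Omega> x *\<^sub>R f x"] f(2) zero nonneg
    by (auto simp: set_integrable_def set_lebesgue_integral_def indicator_def)
  then have "AE x in lborel. x \<in> - ?U" by eventually_elim auto
  then have "AE x in lebesgue. x \<in> - ?U" by (rule AE_completion)
  moreover have "closed (- ?U)" using U by (simp only: closed_def double_complement)
  ultimately have "x \<in> - ?U" by (intro mem_closed_if_AE_lebesgue)
  then show ?thesis using x by auto
qed

text \<open>
  Eigenfunctions are cut off to \<open>0\<close> outside \<open>\<Omega>\<close>; this lemma and the next one transfer statements between
  a function and its cut-off, which agree on \<open>\<Omega>\<close> only.
\<close>

lemma C2_on_cong: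
  assumes \<Omega>: "open \<Omega>" and u: "C2_on \<Omega> u" and eq: "\<And>y. y \<in> \<Omega> \<Longrightarrow> u y = w y"
  shows "C2_on \<Omega> w"
    and "b \<in> Basis \<Longrightarrow> x \<in> \<Omega> \<Longrightarrow> partial b (partial b w) x = partial b (partial b u) x"
proof -
  have C1: "C1_on \<Omega> u" "\<And>b. b \<in> Basis \<Longrightarrow> C1_on \<Omega> (partial b u)" using u by (auto simp: C2_on_def)
  have p: "partial b u y = partial b w y" if "y \<in> \<Omega>" for y b
    using partial_cong_open(1)[OF \<Omega> that eq, where b=b] C1(1) that by (auto simp: C1_on_def)
  show "C2_on \<Omega> w"
    unfolding C2_on_def using C1_on_cong[OF \<Omega> C1(1) eq] C1_on_cong[OF \<Omega> C1(2) p] by auto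
  show "partial b (partial b w) x = partial b (partial b u) x" if "b \<in> Basis" "x \<in> \<Omega>"
    using partial_cong_open(1)[OF \<Omega> that(2) p, where b=b] C1(2)[OF that(1)] that by (auto simp: C1_on_def)
qed

lemma H10_cong:
  assumes \<Omega>: "open \<Omega>" and u: "u \<in> H10 \<Omega>" and eq: "\<And>y. y \<in> \<Omega> \<Longrightarrow> u y = w y"
  shows "w \<in> H10 \<Omega>"
proof -
  note C1 = H10_integrable[OF u]
  have p: "partial b w y = partial b u y" if "y \<in> \<Omega>" for y b
    using partial_cong_open(1)[OF \<Omega> that eq, where b=b] C1(1) that by (auto simp: C1_on_def)
  have Cw: "C1_on \<Omega> w" by (rule C1_on_cong[OF \<Omega> C1(1) eq])
  have H: "H1_density u x = H1_density w x" if "x \<in> \<Omega>" for x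
    using that eq p by (simp add: H1_density_def)
  have Hd: "H1_density (\<lambda>y. w y - \<psi> y) x = H1_density (\<lambda>y. u y - \<psi> y) x"
    if "x \<in> \<Omega>" "\<psi> \<in> C1_compact_support \<Omega>" for x \<psi>
    using that eq p C1(1) Cw by (simp add: H1_density_def C1_compact_support_def C1_on_def partial_diff)
  have "set_integrable lborel \<Omega> (H1_density w)"
    using C1(2) set_integrable_cong[of lborel lborel \<Omega> \<Omega> "H1_density u" "H1_density w", OF refl refl H] by simp
  moreover have "(LINT x:\<Omega>|lborel. H1_density (\<lambda>y. w y - \<psi> y) x) = (LINT x:\<Omega>|lborel. H1_density (\<lambda>y. u y - \<psi> y) x)"
    if "\<psi> \<in> C1_compact_support \<Omega>" for \<psi>
    using Hd that \<Omega> by (intro set_lebesgue_integral_cong) auto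
  ultimately show ?thesis using u Cw by (auto simp: H10_def)
qed

text \<open>
  A \<open>C\<^sup>1\<close> modification of the identity that vanishes for \<open>\<bar>s\<bar> \<le> d\<close>. For \<open>s \<noteq> 0\<close> and small \<open>d\<close> it is close
  to \<open>s * (s\<^sup>2)\<^sup>2 / s\<^sup>4 = s\<close>; the summand \<open>d\<close> in the denominator keeps the formula free of a singularity
  at \<open>0\<close>.
\<close>

definition cutoff :: "real \<Rightarrow> real \<Rightarrow> real"
  where "cutoff d s = s * (max 0 (s\<^sup>2 - d\<^sup>2))\<^sup>2 / (s ^ 4 + d)"

text \<open>
  The derivative of \<open>cutoff d\<close>, arranged so that each of the three fractions lies between \<open>0\<close> and \<open>1\<close>.
\<close>

definition cutoff' :: "real \<Rightarrow> real \<Rightarrow> real"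
  where "cutoff' d s = (max 0 (s\<^sup>2 - d\<^sup>2))\<^sup>2 / (s ^ 4 + d) + 4 * (s\<^sup>2 * max 0 (s\<^sup>2 - d\<^sup>2) / (s ^ 4 + d))
     - 4 * (s ^ 4 * (max 0 (s\<^sup>2 - d\<^sup>2))\<^sup>2 / (s ^ 4 + d)\<^sup>2)"

lemma has_real_derivative_positive_part_square:
  "((\<lambda>y. (max 0 y)\<^sup>2) has_real_derivative 2 * max 0 y) (at (y::real))"
proof -
  consider "y < 0" | "y = 0" | "0 < y" by linarith
  then show ?thesis
  proof cases
    case 1
    have "((\<lambda>_. 0) has_real_derivative 2 * max 0 y) (at y)" using 1 by simp
    then show ?thesis by (rule has_field_derivative_transform_within_open[of _ _ _ "{..<0}"]) (use 1 in auto)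
  next
    case 3
    have "((\<lambda>y. y\<^sup>2) has_real_derivative 2 * max 0 y) (at y)" using 3 by (auto intro!: derivative_eq_intros)
    then show ?thesis by (rule has_field_derivative_transform_within_open[of _ _ _ "{0<..}"]) (use 3 in auto)
  next
    case 2
    have "((\<lambda>h::real. (max 0 h)\<^sup>2 / h) \<longlongrightarrow> 0) (at 0)"
    proof (rule Lim_null_comparison)
      show "\<forall>\<^sub>F h in at 0. norm ((max 0 h)\<^sup>2 / h) \<le> \<bar>h::real\<bar>"
        by (intro always_eventually allI) (auto simp: max_def power2_eq_square)
      show "((\<lambda>h::real. \<bar>h\<bar>) \<longlongrightarrow> 0) (at 0)" by (intro tendsto_eq_intros) auto
    qed
    then show ?thesis using 2 by (simp add: has_field_derivative_iff)
  qed
qed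

context
  fixes d :: real assumes d: "0 < d"
begin

lemma cutoff_denominator_pos: "0 < s ^ 4 + d"
  using d by (intro add_nonneg_pos) auto

lemma cutoff_has_derivative: "(cutoff d has_real_derivative cutoff' d s) (at s)"
proof -
  define P D where "P = max 0 (s\<^sup>2 - d\<^sup>2)" and "D = s ^ 4 + d"
  have D0: "D \<noteq> 0" using cutoff_denominator_pos[of s] by (simp add: D_def)
  have "((\<lambda>s. (max 0 (s\<^sup>2 - d\<^sup>2))\<^sup>2) has_real_derivative 2 * P * (2 * s)) (at s)"
    unfolding P_def
    by (rule DERIV_chain2[OF has_real_derivative_positive_part_square]) (auto intro!: derivative_eq_intros)
  then have N: "((\<lambda>s. s * (max 0 (s\<^sup>2 - d\<^sup>2))\<^sup>2) has_real_derivative 1 * P\<^sup>2 + 2 * P * (2 * s) * s) (at s)"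
    unfolding P_def by (rule DERIV_mult[OF DERIV_ident])
  have D: "((\<lambda>s. s ^ 4 + d) has_real_derivative 4 * s ^ 3) (at s)" by (auto intro!: derivative_eq_intros)
  have "(cutoff d has_real_derivative ((1 * P\<^sup>2 + 2 * P * (2 * s) * s) * D - s * P\<^sup>2 * (4 * s ^ 3)) / (D * D)) (at s)"
    using DERIV_divide[OF N D] D0 unfolding cutoff_def[abs_def] P_def D_def by simp
  moreover have "((1 * P\<^sup>2 + 2 * P * (2 * s) * s) * D - s * P\<^sup>2 * (4 * s ^ 3)) / (D * D) = cutoff' d s"
    unfolding cutoff'_def P_def[symmetric] D_def[symmetric]
    using D0 by (simp add: field_simps power2_eq_square power4_eq_xxxx power3_eq_cube)
  ultimately show ?thesis by simp
qed

lemma continuous_on_cutoff': "continuous_on A (cutoff' d)"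
proof -
  have "s ^ 4 + d \<noteq> 0" for s using cutoff_denominator_pos[of s] by simp
  then show ?thesis unfolding cutoff'_def[abs_def] by (auto intro!: continuous_intros)
qed

lemma cutoff_eq_0: "\<bar>s\<bar> \<le> d \<Longrightarrow> cutoff d s = 0"
  using abs_le_square_iff[of s d] d by (simp add: cutoff_def)

text \<open>
  With \<open>P = max 0 (s\<^sup>2 - d\<^sup>2) \<le> s\<^sup>2\<close> and \<open>D = s\<^sup>4 + d \<ge> s\<^sup>4\<close>, the ratios \<open>P\<^sup>2 / D\<close>, \<open>s\<^sup>2 P / D\<close> and
  \<open>s\<^sup>4 P\<^sup>2 / D\<^sup>2\<close> all lie in \<open>[0, 1]\<close>. The bounds are uniform in \<open>d\<close>, as dominated convergence requires.
\<close>

lemma cutoff_bounds: "\<bar>s - cutoff d s\<bar> \<le> \<bar>s\<bar>" "\<bar>1 - cutoff' d s\<bar> \<le> 10"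
proof -
  define P D where "P = max 0 (s\<^sup>2 - d\<^sup>2)" and "D = s ^ 4 + d"
  have D: "0 < D" "s ^ 4 \<le> D" unfolding D_def using cutoff_denominator_pos d by auto
  have P: "0 \<le> P" "P \<le> s\<^sup>2" by (auto simp: P_def)
  have s4: "s ^ 4 = s\<^sup>2 * s\<^sup>2" by (simp add: power2_eq_square power4_eq_xxxx)
  have P2: "P\<^sup>2 \<le> D" "s\<^sup>2 * P \<le> D"
    using mult_mono[OF P(2,2) _ P(1)] mult_left_mono[OF P(2), of "s\<^sup>2"] D(2) s4 by (simp_all add: power2_eq_square)
  have r: "0 \<le> P\<^sup>2 / D" "P\<^sup>2 / D \<le> 1" "0 \<le> s\<^sup>2 * P / D" "s\<^sup>2 * P / D \<le> 1"
    using P P2 D by auto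
  have s4P: "s ^ 4 * P\<^sup>2 / D\<^sup>2 = s ^ 4 / D * (P\<^sup>2 / D)" by (simp add: power2_eq_square)
  have "0 \<le> s ^ 4 / D" "s ^ 4 / D \<le> 1" using D by auto
  then have r': "0 \<le> s ^ 4 * P\<^sup>2 / D\<^sup>2" "s ^ 4 * P\<^sup>2 / D\<^sup>2 \<le> 1"
    using r mult_le_one[of "s ^ 4 / D" "P\<^sup>2 / D"] unfolding s4P by auto
  have c: "cutoff d s = s * (P\<^sup>2 / D)" by (simp add: cutoff_def P_def D_def)
  have "\<bar>s - cutoff d s\<bar> = \<bar>s\<bar> * (1 - P\<^sup>2 / D)"
    unfolding c using r abs_mult[of s "1 - P\<^sup>2 / D"] by (simp add: algebra_simps)
  also have "\<dots> \<le> \<bar>s\<bar> * 1" using r by (intro mult_left_mono) auto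
  finally show "\<bar>s - cutoff d s\<bar> \<le> \<bar>s\<bar>" by simp
  have "cutoff' d s = P\<^sup>2 / D + 4 * (s\<^sup>2 * P / D) - 4 * (s ^ 4 * P\<^sup>2 / D\<^sup>2)"
    by (simp add: cutoff'_def P_def D_def)
  then show "\<bar>1 - cutoff' d s\<bar> \<le> 10" using r r' by linarith
qed

end

lemma cutoff_tendsto:
  assumes d: "d \<longlonglongrightarrow> 0" "s \<noteq> 0"
  shows "(\<lambda>m. cutoff (d m) s) \<longlonglongrightarrow> s" "(\<lambda>m. cutoff' (d m) s) \<longlonglongrightarrow> 1"
proof -
  have P: "(\<lambda>m. max 0 (s\<^sup>2 - (d m)\<^sup>2)) \<longlonglongrightarrow> s\<^sup>2"
    by (rule tendsto_eq_intros d(1) refl)+ simp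
  have D: "(\<lambda>m. s ^ 4 + d m) \<longlonglongrightarrow> s ^ 4" by (rule tendsto_eq_intros d(1) refl)+ simp
  have "(\<lambda>m. cutoff (d m) s) \<longlonglongrightarrow> s * (s\<^sup>2)\<^sup>2 / s ^ 4"
    unfolding cutoff_def using d(2) by (intro tendsto_intros P D) auto
  then show "(\<lambda>m. cutoff (d m) s) \<longlonglongrightarrow> s"
    using d(2) by (simp add: power2_eq_square power4_eq_xxxx)
  have "(\<lambda>m. cutoff' (d m) s) \<longlonglongrightarrow> (s\<^sup>2)\<^sup>2 / s ^ 4 + 4 * (s\<^sup>2 * s\<^sup>2 / s ^ 4) - 4 * (s ^ 4 * (s\<^sup>2)\<^sup>2 / (s ^ 4)\<^sup>2)"
    unfolding cutoff'_def using d(2) by (intro tendsto_intros P D) auto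
  then show "(\<lambda>m. cutoff' (d m) s) \<longlonglongrightarrow> 1"
    using d(2) by (simp add: power2_eq_square power4_eq_xxxx)
qed

lemma partial_compose:
  assumes "(F has_real_derivative F' (u x)) (at (u x))" "u differentiable (at x)"
  shows "partial b (\<lambda>y. F (u y)) x = F' (u x) * partial b u x" "(\<lambda>y. F (u y)) differentiable (at x)"
proof -
  have "((\<lambda>y. F (u y)) has_derivative (\<lambda>b. F' (u x) * partial b u x)) (at x)"
    using diff_chain_at[OF has_derivative_frechet[OF assms(2)] assms(1)[unfolded has_field_derivative_def]]
    by (simp add: o_def)
  then show "partial b (\<lambda>y. F (u y)) x = F' (u x) * partial b u x" "(\<lambda>y. F (u y)) differentiable (at x)"
    by (auto simp: partial_eqI differentiable_def)
qed

lemma C1_on_compose: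
  assumes F: "\<And>s. (F has_real_derivative F' s) (at s)" "continuous_on UNIV F'" and u: "C1_on S u"
  shows "C1_on S (\<lambda>y. F (u y))"
proof -
  have "continuous_on S (\<lambda>y. F' (u y))"
    using continuous_on_compose2[OF F(2) C1_on_continuous_on[OF u]] by auto
  moreover have "continuous_on S (partial b u)" if "b \<in> Basis" for b using u that unfolding C1_on_def by blast
  ultimately have "continuous_on S (\<lambda>x. F' (u x) * partial b u x)" if "b \<in> Basis" for b
    using that by (intro continuous_on_mult)
  moreover have d: "u differentiable (at x)" if "x \<in> S" for x using u that unfolding C1_on_def by blast
  moreover note partial_compose(1)[of F F' u, OF F(1) d, symmetric]
  ultimately have "continuous_on S (partial b (\<lambda>y. F (u y)))" if "b \<in> Basis" for b
    using that by (blast intro: continuous_on_eq)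
  moreover have "(\<lambda>y. F (u y)) differentiable (at x)" if "x \<in> S" for x
    by (rule partial_compose(2)[of F F' u x, OF F(1) d[OF that]])
  ultimately show ?thesis unfolding C1_on_def by blast
qed

text \<open>
  The functions \<open>cutoff d \<circ> u\<close> are supported where \<open>\<bar>u\<bar> \<ge> d\<close>, which is a compact subset of \<open>\<Omega>\<close> because \<open>u\<close>
  vanishes on the boundary. As \<open>d\<close> tends to \<open>0\<close> they converge to \<open>u\<close> together with their gradients wherever
  \<open>u \<noteq> 0\<close>, and the uniform bounds on the cut-off dominate the error by \<open>100\<close> times the \<open>H\<^sup>1\<close> density of \<open>u\<close>.
\<close>

lemma vanishing_on_frontier_imp_H10:
  fixes u :: "'a::euclidean_space \<Rightarrow> real"
  assumes \<Omega>: "open \<Omega>" "bounded \<Omega>" and u: "C1_on UNIV u" and bd: "\<And>x. x \<in> frontier \<Omega> \<Longrightarrow> u x = 0"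
    and nz: "AE x in lborel. u x \<noteq> 0"
  shows "u \<in> H10 \<Omega>"
proof -
  have C: "C1_on \<Omega> u" using C1_on_subset[OF u] by simp
  have comp: "compact (closure \<Omega>)" using \<Omega>(2) by simp
  have "set_integrable lborel (closure \<Omega>) (H1_density u)"
    unfolding set_integrable_def
    by (intro borel_integrable_compact comp continuous_on_H1_density C1_on_subset[OF u]) simp
  then have int: "set_integrable lborel \<Omega> (H1_density u)"
    by (rule set_integrable_subset) (use \<Omega> closure_subset in auto)
  define d where "d m = inverse (real (Suc m))" for m
  have d: "0 < d m" for m by (simp add: d_def)
  have d0: "d \<longlonglongrightarrow> 0" unfolding d_def by (rule LIMSEQ_inverse_real_of_nat)
  define \<psi> where "\<psi> m x = (if x \<in> \<Omega> then cutoff (d m) (u x) else 0)" for m x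
  have Cc: "C1_on \<Omega> (\<lambda>y. cutoff (d m) (u y))" for m
    by (rule C1_on_compose[OF cutoff_has_derivative[OF d] continuous_on_cutoff'[OF d] C])
  have \<psi>: "\<psi> m \<in> C1_compact_support \<Omega>" for m
  proof -
    define K where "K = closure \<Omega> \<inter> {x. d m \<le> \<bar>u x\<bar>}"
    have "closed {x. d m \<le> \<bar>u x\<bar>}"
      using C1_on_continuous_on[OF u] by (intro closed_Collect_le continuous_intros)
    then have K: "compact K" unfolding K_def by (rule compact_Int_closed[OF comp])
    have "closure \<Omega> = \<Omega> \<union> frontier \<Omega>" using closure_Un_frontier[of \<Omega>] by simp
    then have K\<Omega>: "K \<subseteq> \<Omega>" using bd d[of m] by (force simp: K_def)
    have K0: "\<psi> m x = 0" if "x \<notin> K" for x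
      using that cutoff_eq_0[OF d, of "u x" m] closure_subset[of \<Omega>] by (auto simp: \<psi>_def K_def)
    have "C1_on \<Omega> (\<psi> m)" by (rule C1_on_cong[OF \<Omega>(1) Cc]) (simp add: \<psi>_def)
    then have "C1_on UNIV (\<psi> m)" by (rule C1_on_UNIV_extend[OF \<Omega>(1) K K\<Omega>]) (rule K0)
    then show ?thesis using K K\<Omega> K0 by (auto simp: C1_compact_support_def)
  qed
  have H: "H1_density (\<lambda>y. u y - \<psi> m y) x
      = (u x - cutoff (d m) (u x))\<^sup>2 + (1 - cutoff' (d m) (u x))\<^sup>2 * (\<Sum>b\<in>Basis. (partial b u x)\<^sup>2)"
    if x: "x \<in> \<Omega>" for x m
  proof -
    have du: "u differentiable (at x)" "(\<psi> m) differentiable (at x)"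
      using x C C1_compact_support_integrable(1)[OF \<psi>] by (auto simp: C1_on_def)
    have "partial b (\<psi> m) x = cutoff' (d m) (u x) * partial b u x" for b
      using partial_cong_open(1)[OF \<Omega>(1) x, of "\<lambda>y. cutoff (d m) (u y)" "\<psi> m" b]
        partial_compose[of "cutoff (d m)" "cutoff' (d m)" u x, OF cutoff_has_derivative[OF d] du(1)]
      by (simp add: \<psi>_def)
    then have "partial b (\<lambda>y. u y - \<psi> m y) x = (1 - cutoff' (d m) (u x)) * partial b u x" for b
      by (simp add: partial_diff[OF du] algebra_simps)
    then show ?thesis using x by (simp add: H1_density_def \<psi>_def power_mult_distrib sum_distrib_left)
  qed
  have "(\<lambda>m. LINT x|lborel. indicator \<Omega> x *\<^sub>R H1_density (\<lambda>y. u y - \<psi> m y) x) \<longlonglongrightarrow> (LINT (x::'a)|lborel. 0)"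
  proof (rule integral_dominated_convergence)
    show "integrable lborel (\<lambda>x. indicator \<Omega> x *\<^sub>R (100 * H1_density u x))"
      using set_integrable_mult_right[OF int, of 100] by (simp add: set_integrable_def)
    show "(\<lambda>x. indicator \<Omega> x *\<^sub>R H1_density (\<lambda>y. u y - \<psi> m y) x) \<in> borel_measurable lborel" for m
      using H1_density_diff_integrable[OF \<Omega>(1) C int C1_compact_support_integrable[OF \<psi>]]
      by (auto simp: set_integrable_def)
    show "AE x in lborel. (\<lambda>m. indicator \<Omega> x *\<^sub>R H1_density (\<lambda>y. u y - \<psi> m y) x) \<longlonglongrightarrow> 0"
      using nz
    proof eventually_elim
      case (elim x)
      have "(\<lambda>m. (u x - cutoff (d m) (u x))\<^sup>2 + (1 - cutoff' (d m) (u x))\<^sup>2 * (\<Sum>b\<in>Basis. (partial b u x)\<^sup>2)) \<longlonglongrightarrow> 0"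
        by (rule tendsto_eq_intros cutoff_tendsto[OF d0 elim] refl)+ simp
      then show ?case by (cases "x \<in> \<Omega>") (simp_all add: H)
    qed
    show "AE x in lborel. norm (indicator \<Omega> x *\<^sub>R H1_density (\<lambda>y. u y - \<psi> m y) x) \<le> indicator \<Omega> x *\<^sub>R (100 * H1_density u x)" for m
    proof (intro always_eventually allI)
      fix x
      have "(u x - cutoff (d m) (u x))\<^sup>2 \<le> (u x)\<^sup>2" "(1 - cutoff' (d m) (u x))\<^sup>2 \<le> 10\<^sup>2"
        using cutoff_bounds[OF d[of m], of "u x"] abs_le_square_iff power_mono[of "\<bar>1 - cutoff' (d m) (u x)\<bar>" 10 2]
        by auto
      then have "(u x - cutoff (d m) (u x))\<^sup>2 + (1 - cutoff' (d m) (u x))\<^sup>2 * (\<Sum>b\<in>Basis. (partial b u x)\<^sup>2)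
         \<le> (u x)\<^sup>2 + 10\<^sup>2 * (\<Sum>b\<in>Basis. (partial b u x)\<^sup>2)"
        by (intro add_mono mult_right_mono) (auto intro: sum_nonneg)
      also have "\<dots> \<le> 100 * H1_density u x" by (simp add: H1_density_def)
      finally show "norm (indicator \<Omega> x *\<^sub>R H1_density (\<lambda>y. u y - \<psi> m y) x) \<le> indicator \<Omega> x *\<^sub>R (100 * H1_density u x)"
        using H[of x m] H1_density_nonneg[of "\<lambda>y. u y - \<psi> m y" x] by (cases "x \<in> \<Omega>") auto
    qed
  qed simp
  then have lim: "(\<lambda>m. LINT x:\<Omega>|lborel. H1_density (\<lambda>y. u y - \<psi> m y) x) \<longlonglongrightarrow> 0"
    by (simp add: set_lebesgue_integral_def)
  have "\<exists>\<psi>\<in>C1_compact_support \<Omega>. (LINT x:\<Omega>|lborel. H1_density (\<lambda>y. u y - \<psi> y) x) < \<epsilon>" if "0 < \<epsilon>" for \<epsilon>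
    using order_tendstoD(2)[OF lim that] \<psi> by (auto simp: eventually_sequentially)
  then show ?thesis using C int by (auto simp: H10_def)
qed

section \<open>Products of sines as Dirichlet eigenfunctions of the cube\<close>

lemma Basis_cart: "(Basis :: (real^'n::finite) set) = range (\<lambda>i. axis i 1)"
  by (auto simp: Basis_vec_def)

lemma sum_Basis_cart: "(\<Sum>b\<in>(Basis :: (real^'n::finite) set). f b) = (\<Sum>i\<in>UNIV. f (axis i 1))"
  unfolding Basis_cart by (subst sum.reindex) (auto simp: inj_on_def axis_eq_axis)

definition tensor :: "('n::finite \<Rightarrow> real \<Rightarrow> real) \<Rightarrow> real^'n \<Rightarrow> real"
  where "tensor g x = (\<Prod>i\<in>UNIV. g i (x $ i))"

lemma tensor_upd: "tensor (g(i := f)) x = f (x $ i) * (\<Prod>j\<in>UNIV - {i}. g j (x $ j))"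
  unfolding tensor_def by (subst prod.remove[of _ i]) auto

text \<open>
  Differentiating a product of functions of the separate coordinates changes one factor, so that the result
  is again such a product and the lemma can be iterated.
\<close>

lemma partial_tensor:
  assumes "\<And>i t. (g i has_real_derivative g' i t) (at t)"
  shows "tensor g differentiable (at x)" "partial (axis i 1) (tensor g) x = tensor (g(i := g' i)) x"
proof -
  have "((\<lambda>x. g i (x $ i)) has_derivative (\<lambda>h. g' i (x $ i) * h $ i)) (at x)" for i x
    using diff_chain_at[OF bounded_linear_imp_has_derivative[OF bounded_linear_vec_nth] assms[unfolded has_field_derivative_def]]
    by (simp add: o_def)
  then have D: "(tensor g has_derivative (\<lambda>h. \<Sum>i\<in>UNIV. g' i (x $ i) * h $ i * (\<Prod>j\<in>UNIV - {i}. g j (x $ j)))) (at x)"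
    unfolding tensor_def[abs_def] by (rule has_derivative_prod)
  then show "tensor g differentiable (at x)" by (auto simp: differentiable_def)
  show "partial (axis i 1) (tensor g) x = tensor (g(i := g' i)) x"
    unfolding partial_eqI[OF D] tensor_upd by (subst sum.remove[of _ i]) (auto simp: axis_def)
qed

lemma continuous_on_tensor:
  assumes "\<And>i. continuous_on UNIV (g i)"
  shows "continuous_on S (tensor g)"
  unfolding tensor_def[abs_def]
  by (intro continuous_on_prod continuous_on_compose2[OF assms] continuous_intros) auto

lemma C1_on_tensor:
  assumes "\<And>i t. (g i has_real_derivative g' i t) (at t)" "\<And>i. continuous_on UNIV (g' i)"
  shows "C1_on S (tensor g)"
proof -
  have g: "continuous_on UNIV (g i)" for i
    using assms(1) DERIV_isCont by (intro continuous_at_imp_continuous_on) blast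
  have "continuous_on S (tensor (g(i := g' i)))" for i
    using g assms(2) by (intro continuous_on_tensor) auto
  then show ?thesis
    unfolding C1_on_def Basis_cart using partial_tensor[of g g', OF assms(1)]
    by (auto intro: continuous_on_eq)
qed

definition sine_mode :: "('n::finite \<Rightarrow> nat) \<Rightarrow> real^'n \<Rightarrow> real"
  where "sine_mode k = tensor (\<lambda>i t. sin (real (k i) * t))"

lemma sine_mode_apply: "sine_mode k x = (\<Prod>i\<in>UNIV. sin (real (k i) * x $ i))"
  by (simp add: sine_mode_def tensor_def)

lemma sine_mode_C2: "C2_on UNIV (sine_mode k)"
  and sine_mode_partial2: "partial (axis i 1) (partial (axis i 1) (sine_mode k)) x = - (real (k i))\<^sup>2 * sine_mode k x"
proof -
  let ?s = "\<lambda>i t. sin (real (k i) * t)" and ?c = "\<lambda>i t. real (k i) * cos (real (k i) * t)"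
    and ?d = "\<lambda>i t. - (real (k i))\<^sup>2 * sin (real (k i) * t)"
  have s: "(?s i has_real_derivative ?c i t) (at t)" for i t by (auto intro!: derivative_eq_intros)
  have c: "(?c i has_real_derivative ?d i t) (at t)" for i t
    by (auto intro!: derivative_eq_intros simp: power2_eq_square)
  have cont: "continuous_on UNIV (?c i)" "continuous_on UNIV (?d i)" for i by (auto intro!: continuous_intros)
  have p: "partial (axis i 1) (sine_mode k) = tensor (?s(i := ?c i))" for i
    unfolding sine_mode_def by (intro ext partial_tensor(2)[of ?s ?c] s)
  have s': "((?s(i := ?c i)) j has_real_derivative (?c(i := ?d i)) j t) (at t)" for i j t
    using s c by auto
  have "C1_on UNIV (tensor (?s(i := ?c i)))" for i
    using cont by (intro C1_on_tensor[of _ "?c(i := ?d i)"] s') auto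
  moreover have "C1_on UNIV (sine_mode k)"
    unfolding sine_mode_def using cont by (intro C1_on_tensor[of _ ?c] s) auto
  ultimately show "C2_on UNIV (sine_mode k)"
    unfolding C2_on_def Basis_cart by (auto simp: p)
  have "partial (axis i 1) (tensor (?s(i := ?c i))) x = tensor (?s(i := ?d i)) x"
    using partial_tensor(2)[of "?s(i := ?c i)" "?c(i := ?d i)" i x, OF s'] by simp
  also have "\<dots> = - (real (k i))\<^sup>2 * tensor ?s x"
    unfolding tensor_upd unfolding tensor_def by (subst (2) prod.remove[of _ i]) auto
  finally show "partial (axis i 1) (partial (axis i 1) (sine_mode k)) x = - (real (k i))\<^sup>2 * sine_mode k x"
    unfolding p by (simp add: sine_mode_def)
qed

text \<open>
  The zeros lie on the countably many hyperplanes \<open>x\<^sub>i = j \<pi> / k\<^sub>i\<close>.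
\<close>

lemma AE_sine_mode_nonzero:
  assumes "\<And>i. 1 \<le> k i"
  shows "AE x in lborel. sine_mode k x \<noteq> 0"
proof -
  have "AE x in lborel. \<forall>i. \<forall>j::int. x \<bullet> axis i (1::real) \<noteq> real_of_int j * pi / real (k i)"
    unfolding AE_all_countable by (intro allI AE_lborel_inner_neq) simp
  then show ?thesis
  proof eventually_elim
    case (elim x)
    have "sin (real (k i) * x $ i) \<noteq> 0" for i
    proof
      assume "sin (real (k i) * x $ i) = 0"
      then obtain j :: int where "real (k i) * x $ i = of_int j * pi" by (auto simp: sin_zero_iff_int2)
      then have "x $ i = of_int j * pi / real (k i)" using assms[of i] by (simp add: field_simps)
      then show False using elim by (simp add: cart_eq_inner_axis)
    qed
    then show ?case by (simp add: sine_mode_apply)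
  qed
qed

lemma open_hypercube: "open (hypercube :: (real^'n::finite) set)"
  and closure_hypercube: "closure (hypercube :: (real^'n::finite) set) \<subseteq> {x. \<forall>i. 0 \<le> x $ i \<and> x $ i \<le> pi}"
  and bounded_hypercube: "bounded (hypercube :: (real^'n::finite) set)"
proof -
  have h: "(hypercube :: (real^'n) set) = box 0 (\<chi> i. pi)" by (auto simp: hypercube_def mem_box_cart)
  show "open (hypercube :: (real^'n) set)" unfolding h by (rule open_box)
  show "bounded (hypercube :: (real^'n) set)" unfolding h by (rule bounded_box)
  have "closed (cbox 0 (\<chi> i. pi) :: (real^'n) set)" by (rule closed_cbox)
  moreover have "(cbox 0 (\<chi> i. pi) :: (real^'n) set) = {x. \<forall>i. 0 \<le> x $ i \<and> x $ i \<le> pi}"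
    by (auto simp: mem_box_cart)
  ultimately show "closure (hypercube :: (real^'n) set) \<subseteq> {x. \<forall>i. 0 \<le> x $ i \<and> x $ i \<le> pi}"
    by (intro closure_minimal) (auto simp: hypercube_def less_imp_le)
qed

text \<open>
  Elements of the eigenspace vanish outside the cube. The uncut product \<open>sine_mode k\<close> is kept alongside because it is
  smooth on the whole space, so that calculus and compactness arguments apply to it across the boundary.
\<close>

definition cube_mode :: "('n::finite \<Rightarrow> nat) \<Rightarrow> real^'n \<Rightarrow> real"
  where "cube_mode k x = (if x \<in> hypercube then sine_mode k x else 0)"

definition mode_energy :: "('n::finite \<Rightarrow> nat) \<Rightarrow> nat"
  where "mode_energy k = (\<Sum>i\<in>UNIV. (k i)\<^sup>2)"

lemma cube_mode_C2: "C2_on hypercube (cube_mode k)"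
  and cube_mode_partial2: "x \<in> hypercube \<Longrightarrow>
      partial (axis i 1) (partial (axis i 1) (cube_mode k)) x = - (real (k i))\<^sup>2 * cube_mode k x"
proof -
  have C2: "C2_on hypercube (sine_mode k)"
    using sine_mode_C2[of k] by (auto simp: C2_on_def intro: C1_on_subset)
  have eq: "sine_mode k y = cube_mode k y" if "y \<in> hypercube" for y using that by (simp add: cube_mode_def)
  note c = C2_on_cong[OF open_hypercube C2 eq]
  show "C2_on hypercube (cube_mode k)" by (rule c(1))
  show "partial (axis i 1) (partial (axis i 1) (cube_mode k)) x = - (real (k i))\<^sup>2 * cube_mode k x"
    if "x \<in> hypercube" using c(2)[of "axis i 1" x] eq that by (simp add: sine_mode_partial2)
qed

lemma cube_mode_H10:
  assumes "\<And>i. 1 \<le> k i"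
  shows "cube_mode k \<in> H10 hypercube"
proof -
  have "sine_mode k x = 0" if x: "x \<in> frontier hypercube" for x
  proof -
    have "x \<notin> hypercube" using x by (simp add: frontier_def interior_open[OF open_hypercube])
    moreover have "\<forall>i. 0 \<le> x $ i \<and> x $ i \<le> pi" using x closure_hypercube by (auto simp: frontier_def)
    ultimately obtain i where "x $ i = 0 \<or> x $ i = pi" by (auto simp: hypercube_def order_le_less)
    then have "sin (real (k i) * x $ i) = 0" by auto
    then show ?thesis by (auto simp: sine_mode_apply)
  qed
  then have "sine_mode k \<in> H10 hypercube"
    using sine_mode_C2[of k] AE_sine_mode_nonzero[OF assms]
    by (intro vanishing_on_frontier_imp_H10 open_hypercube bounded_hypercube) (auto simp: C2_on_def)
  then show ?thesis by (rule H10_cong[OF open_hypercube]) (simp add: cube_mode_def)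
qed

lemma cube_mode_eigenfunction:
  assumes "\<And>i. 1 \<le> k i"
  shows "cube_mode k \<in> dirichlet_eigenspace hypercube (real (mode_energy k))"
  using cube_mode_C2[of k] cube_mode_H10[OF assms]
  by (auto simp: dirichlet_eigenspace_def laplacian_def sum_Basis_cart cube_mode_partial2 mode_energy_def
      sum_negf sum_distrib_right cube_mode_def[of k])

text \<open>
  Modes with equal energy are told apart by a single direction: \<open>\<partial>\<^sub>i\<^sup>2\<close> has the eigenvalues \<open>- k\<^sub>i\<^sup>2\<close> and
  \<open>- l\<^sub>i\<^sup>2\<close>, which differ for some \<open>i\<close>.
\<close>

lemma cube_mode_orthogonal:
  assumes "\<And>i. 1 \<le> k i" "\<And>i. 1 \<le> l i" "k \<noteq> l"
  shows "(LINT x:hypercube|lborel. cube_mode k x * cube_mode l x) = 0"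
proof -
  obtain i where i: "k i \<noteq> l i" using assms(3) by auto
  show ?thesis
    by (rule eigenfunctions_orthogonal[OF open_hypercube, of "{axis i 1}" _ "(real (k i))\<^sup>2" _ "(real (l i))\<^sup>2"])
       (use i assms cube_mode_C2 cube_mode_H10 in \<open>auto simp: cube_mode_partial2\<close>)
qed

lemma eigenfunction_orthogonal_cube_mode:
  assumes "u \<in> dirichlet_eigenspace hypercube \<mu>" "\<And>i. 1 \<le> k i" "\<mu> \<noteq> real (mode_energy k)"
  shows "(LINT x:hypercube|lborel. u x * cube_mode k x) = 0"
proof -
  note k = cube_mode_eigenfunction[of k, OF assms(2)]
  show ?thesis
    by (rule eigenfunctions_orthogonal[OF open_hypercube order_refl _ _ _ _ _ _ assms(3)])
       (use assms(1) k in \<open>auto simp: dirichlet_eigenspace_def laplacian_def\<close>)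
qed

text \<open>
  All sines equal \<open>1\<close> at the point with coordinates \<open>\<pi> / (2 k\<^sub>i)\<close>.
\<close>

lemma cube_mode_norm_pos:
  assumes "\<And>i. 1 \<le> k i"
  shows "(LINT x:hypercube|lborel. cube_mode k x * cube_mode k x) \<noteq> 0"
proof
  assume z: "(LINT x:hypercube|lborel. cube_mode k x * cube_mode k x) = 0"
  let ?p = "\<chi> i. pi / (2 * real (k i))"
  have p: "?p \<in> hypercube"
  proof -
    have "pi / (2 * real (k i)) < pi" for i
      using assms[of i] by (simp add: divide_less_eq)
    then show ?thesis using assms by (auto simp: hypercube_def intro!: divide_pos_pos simp: Suc_le_eq)
  qed
  have "C1_on hypercube (cube_mode k)" using cube_mode_C2 by (auto simp: C2_on_def)
  then have "continuous_on hypercube (\<lambda>x. cube_mode k x * cube_mode k x)"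
    by (intro continuous_intros C1_on_continuous_on)
  from set_integral_eq_0_imp_eq_0[OF open_hypercube this product_integrable[OF open_hypercube] _ z p]
  have "cube_mode k ?p = 0" using assms by (simp add: cube_mode_H10)
  then have "sine_mode k ?p = 0" using p by (simp add: cube_mode_def)
  moreover have "real (k i) * (pi / (2 * real (k i))) = pi / 2" for i using assms[of i] by simp
  then have "sine_mode k ?p = 1" by (simp only: sine_mode_apply vec_lambda_beta sin_pi_half prod.neutral_const)
  ultimately show False by simp
qed

section \<open>Completeness of the products of sines\<close>

lemma sine_mode_upd: "sine_mode (k(i := m)) x = sin (real m * x $ i) * (\<Prod>j\<in>UNIV - {i}. sin (real (k j) * x $ j))"
proof -
  have "(\<lambda>j t. sin (real ((k(i := m)) j) * t)) = (\<lambda>j t. sin (real (k j) * t))(i := \<lambda>t. sin (real m * t))"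
    by auto
  then show ?thesis unfolding sine_mode_def by (simp only: tensor_upd)
qed

text \<open>
  By \<open>2 cos t sin (k t) = sin ((k + 1) t) + sin ((k - 1) t)\<close>, multiplication by \<open>cos x\<^sub>i\<close> shifts the \<open>i\<close>-th
  frequency. Frequency \<open>0\<close> is admitted here, where it gives the zero function, so that the shift downwards stays
  inside the family.
\<close>

lemma cos_mult_sine_mode_span:
  assumes "f \<in> span (range sine_mode)"
  shows "(\<lambda>x. cos (x $ i) * f x) \<in> span (range sine_mode)"
proof -
  let ?V = "span (range (sine_mode :: ('a \<Rightarrow> nat) \<Rightarrow> _))"
  have base: "(\<lambda>x. cos (x $ i) * sine_mode k x) \<in> ?V" for k
  proof (cases "k i = 0")
    case True
    then have "\<exists>j. sin (real (k j) * x $ j) = 0" for x by (intro exI[of _ i]) simp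
    then have "(\<lambda>x. cos (x $ i) * sine_mode k x) = 0" by (simp add: sine_mode_apply fun_eq_iff)
    then show ?thesis by (simp add: span_zero)
  next
    case False
    then obtain m where m: "k i = Suc m" by (auto simp: gr0_conv_Suc)
    have trig: "cos t * sin (real (Suc m) * t) = sin (real (Suc (Suc m)) * t) / 2 + sin (real m * t) / 2" for t
    proof -
      have "real (Suc (Suc m)) * t = real (Suc m) * t + t" "real m * t = real (Suc m) * t - t"
        by (simp_all add: algebra_simps)
      then show ?thesis by (simp only: sin_add sin_diff) (simp add: field_simps)
    qed
    have "cos (x $ i) * sine_mode k x = (1/2) * sine_mode (k(i := Suc (Suc m))) x + (1/2) * sine_mode (k(i := m)) x" for x
    proof -
      have "sine_mode k x = sine_mode (k(i := Suc m)) x" using m fun_upd_triv[of k i] by simp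
      then have "cos (x $ i) * sine_mode k x
          = (cos (x $ i) * sin (real (Suc m) * x $ i)) * (\<Prod>j\<in>UNIV - {i}. sin (real (k j) * x $ j))"
        by (simp only: sine_mode_upd mult.assoc)
      then show ?thesis unfolding trig sine_mode_upd by (simp add: algebra_simps)
    qed
    then have "(\<lambda>x. cos (x $ i) * sine_mode k x)
        = (1/2) *\<^sub>R sine_mode (k(i := Suc (Suc m))) + (1/2) *\<^sub>R sine_mode (k(i := m))"
      by (simp add: fun_eq_iff scaleR_fun_def)
    then show ?thesis by (simp add: span_add span_scale span_base)
  qed
  have "subspace {f. (\<lambda>x. cos (x $ i) * f x) \<in> ?V}"
  proof (rule subspaceI; clarsimp)
    have "(\<lambda>x. cos (x $ i) * 0) = (0 :: real^'a \<Rightarrow> real)" by (simp add: fun_eq_iff)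
    then show "(\<lambda>x :: real^'a. 0 :: real) \<in> ?V" using span_zero[of "range sine_mode"] by (simp add: zero_fun_def)
  next
    fix f g :: "real^'a \<Rightarrow> real"
    assume "(\<lambda>x. cos (x $ i) * f x) \<in> ?V" "(\<lambda>x. cos (x $ i) * g x) \<in> ?V"
    from span_add[OF this] show "(\<lambda>x. cos (x $ i) * (f x + g x)) \<in> ?V"
      by (simp add: plus_fun_def distrib_left)
  next
    fix c and f :: "real^'a \<Rightarrow> real"
    assume "(\<lambda>x. cos (x $ i) * f x) \<in> ?V"
    from span_scale[OF this, of c] show "(\<lambda>x. cos (x $ i) * (c *\<^sub>R f) x) \<in> ?V"
      by (simp add: scaleR_fun_def mult.left_commute)
  qed
  from span_minimal[OF _ this, of "range sine_mode"] show ?thesis using assms base by auto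
qed

text \<open>
  The continuous functions that preserve the span of the sine products under multiplication. They form an
  algebra by definition, which is why they are preferred to explicit polynomials in the cosines.
\<close>

definition mode_multipliers :: "(real^'n::finite \<Rightarrow> real) set"
  where "mode_multipliers = {f. continuous_on UNIV f \<and>
    (\<forall>g\<in>span (range sine_mode). (\<lambda>x. f x * g x) \<in> span (range sine_mode))}"

abbreviation closed_hypercube :: "(real^'n::finite) set"
  where "closed_hypercube \<equiv> {x. \<forall>i. 0 \<le> x $ i \<and> x $ i \<le> pi}"

lemma compact_closed_hypercube: "compact (closed_hypercube :: (real^'n::finite) set)"
proof -
  have "(cbox 0 (\<chi> i. pi) :: (real^'n) set) = closed_hypercube" by (auto simp: mem_box_cart)
  then show ?thesis using compact_cbox by metis
qed

text \<open>
  The hypotheses of the Stone--Weierstrass theorem; points of the closed cube are separated by the functions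
  \<open>cos x\<^sub>i\<close>, since the cosine is injective on \<open>[0, \<pi>]\<close>.
\<close>

lemma mode_multipliers_function_ring:
  "function_ring_on mode_multipliers (closed_hypercube :: (real^'n::finite) set)"
proof
  let ?V = "span (range (sine_mode :: ('n \<Rightarrow> nat) \<Rightarrow> _))"
  show "compact (closed_hypercube :: (real^'n) set)" by (rule compact_closed_hypercube)
  show "(\<lambda>_. c) \<in> (mode_multipliers :: (real^'n \<Rightarrow> real) set)" for c
    using span_scale[of _ "range sine_mode" c] by (auto simp: mode_multipliers_def scaleR_fun_def)
  fix f g :: "real^'n \<Rightarrow> real" 
  assume f: "f \<in> mode_multipliers"
  then show "continuous_on closed_hypercube f" by (auto simp: mode_multipliers_def intro: continuous_on_subset)
  assume g: "g \<in> mode_multipliers"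
  show "(\<lambda>x. f x + g x) \<in> mode_multipliers"
    using f g span_add[of _ "range (sine_mode :: ('n \<Rightarrow> nat) \<Rightarrow> _)"]
    by (auto simp: mode_multipliers_def plus_fun_def distrib_right intro!: continuous_intros)
  show "(\<lambda>x. f x * g x) \<in> mode_multipliers"
    using f g by (auto simp: mode_multipliers_def mult.assoc intro!: continuous_intros)
next
  fix x y :: "real^'n"
  assume x: "x \<in> closed_hypercube" and y: "y \<in> closed_hypercube" and "x \<noteq> y"
  then obtain i where i: "x $ i \<noteq> y $ i" by (auto simp: vec_eq_iff)
  then have "cos (x $ i) \<noteq> cos (y $ i)" using x y cos_inj_pi by blast
  moreover have "(\<lambda>x :: real^'n. cos (x $ i)) \<in> mode_multipliers"
    using cos_mult_sine_mode_span by (auto simp: mode_multipliers_def intro!: continuous_intros)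
  ultimately show "\<exists>f\<in>mode_multipliers. f x \<noteq> f y" by (rule bexI)
qed

lemma abs_sine_mode_le_1: "\<bar>sine_mode k x\<bar> \<le> 1"
  unfolding sine_mode_apply abs_prod by (intro prod_le_1) auto

lemma continuous_on_sine_mode: "continuous_on S (sine_mode k)"
  unfolding sine_mode_def by (intro continuous_on_tensor continuous_intros)

text \<open>
  Let \<open>h\<close> be the product of \<open>w\<close> with the ground state. Then \<open>\<integral>h f = 0\<close> for every multiplier \<open>f\<close>, because \<open>f\<close> times
  the ground state is a combination of sine products, and by uniform approximation \<open>\<integral>h g = 0\<close> for every
  continuous \<open>g\<close>. A bump \<open>g\<close> on a ball where \<open>h\<close> has constant sign shows \<open>h = 0\<close>, and the ground state has no
  zero in the cube.
\<close>

lemma sine_modes_complete: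
  fixes w :: "real^'n::finite \<Rightarrow> real"
  assumes cont: "continuous_on hypercube w" and int: "set_integrable lborel hypercube w"
    and orth: "\<And>k. (LINT x:hypercube|lborel. w x * sine_mode k x) = 0" and x0: "x0 \<in> hypercube"
  shows "w x0 = 0"
proof -
  let ?V = "span (range (sine_mode :: ('n \<Rightarrow> nat) \<Rightarrow> _))"
  let ?\<Omega> = "hypercube :: (real^'n) set"
  have \<Omega>: "open ?\<Omega>" by (rule open_hypercube)
  have sub: "?\<Omega> \<subseteq> closed_hypercube" by (auto simp: hypercube_def less_imp_le)
  have intw: "set_integrable lborel ?\<Omega> (\<lambda>x. w x * sine_mode k x)" for k
    by (rule set_integrable_continuous_bound[OF \<Omega> _ set_integrable_abs[OF int]])
       (auto simp: abs_mult intro!: continuous_intros cont continuous_on_sine_mode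
          mult_left_le abs_sine_mode_le_1)
  let ?T = "{f. set_integrable lborel ?\<Omega> (\<lambda>x. w x * f x) \<and> (LINT x:?\<Omega>|lborel. w x * f x) = 0}"
  have "subspace ?T"
  proof (rule subspaceI; clarsimp)
    show "set_integrable lborel ?\<Omega> (\<lambda>x. 0 :: real)" by (simp add: set_integrable_def)
  qed (simp_all add: distrib_left set_integral_add scaleR_fun_def mult.left_commute)
  then have V: "?V \<subseteq> ?T" using intw orth by (intro span_minimal) auto
  define h where "h x = w x * sine_mode (\<lambda>_. 1) x" for x
  have conth: "continuous_on ?\<Omega> h" unfolding h_def by (intro continuous_intros cont continuous_on_sine_mode)
  have inth: "set_integrable lborel ?\<Omega> h" unfolding h_def by (rule intw)
  define I where "I = (LINT x:?\<Omega>|lborel. \<bar>h x\<bar>)"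
  have I: "0 \<le> I" unfolding I_def set_lebesgue_integral_def by (intro integral_nonneg_AE) auto
  have mult: "set_integrable lborel ?\<Omega> (\<lambda>x. h x * f x)" "(LINT x:?\<Omega>|lborel. h x * f x) = 0"
    if "f \<in> mode_multipliers" for f
  proof -
    have "(\<lambda>x. f x * sine_mode (\<lambda>_. 1) x) \<in> ?V" using that span_base[of "sine_mode (\<lambda>_. 1)" "range sine_mode"]
      by (auto simp: mode_multipliers_def)
    then have "(\<lambda>x. f x * sine_mode (\<lambda>_. 1) x) \<in> ?T" using V by blast
    then show "set_integrable lborel ?\<Omega> (\<lambda>x. h x * f x)" "(LINT x:?\<Omega>|lborel. h x * f x) = 0"
      by (simp_all add: h_def mult_ac)
  qed
  have g0: "set_integrable lborel ?\<Omega> (\<lambda>x. h x * g x)" "(LINT x:?\<Omega>|lborel. h x * g x) = 0"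
    if g: "continuous_on UNIV g" for g
  proof -
    have cg: "continuous_on closed_hypercube g" using g continuous_on_subset by blast
    have "bounded (g ` closed_hypercube)"
      by (intro compact_imp_bounded compact_continuous_image cg compact_closed_hypercube)
    then obtain M where M: "\<bar>g x\<bar> \<le> M" if "x \<in> closed_hypercube" for x by (auto simp: bounded_iff)
    show 1: "set_integrable lborel ?\<Omega> (\<lambda>x. h x * g x)"
      by (rule set_integrable_continuous_bound[OF \<Omega> _ set_integrable_mult_right[OF set_integrable_abs[OF inth], of M]])
         (use M sub in \<open>auto simp: abs_mult mult.commute[of M] intro!: continuous_intros conth continuous_on_subset[OF g] mult_left_mono\<close>)
    have "\<bar>LINT x:?\<Omega>|lborel. h x * g x\<bar> \<le> e" if e: "0 < e" for e
    proof -
      obtain f where f: "f \<in> mode_multipliers" "\<And>x. x \<in> closed_hypercube \<Longrightarrow> \<bar>g x - f x\<bar> < e / (I + 1)"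
        using function_ring_on.Stone_Weierstrass_basic[OF mode_multipliers_function_ring cg, of "e / (I + 1)"] e I
        by auto
      have d: "set_integrable lborel ?\<Omega> (\<lambda>x. h x * (g x - f x))"
        using set_integral_diff(1)[OF 1 mult(1)[OF f(1)]] by (simp add: algebra_simps)
      have "(LINT x:?\<Omega>|lborel. h x * g x) = (LINT x:?\<Omega>|lborel. h x * (g x - f x))"
        using set_integral_diff(2)[OF 1 mult(1)[OF f(1)]] mult(2)[OF f(1)] by (simp add: algebra_simps)
      also have "\<bar>\<dots>\<bar> \<le> (LINT x:?\<Omega>|lborel. \<bar>h x * (g x - f x)\<bar>)"
        using integral_norm_bound[of lborel "\<lambda>x. indicator ?\<Omega> x *\<^sub>R (h x * (g x - f x))"]
        by (simp add: set_lebesgue_integral_def abs_mult)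
      also have "\<dots> \<le> (LINT x:?\<Omega>|lborel. e / (I + 1) * \<bar>h x\<bar>)"
      proof (rule set_integral_mono[OF set_integrable_abs[OF d] set_integrable_mult_right[OF set_integrable_abs[OF inth]]])
        fix x assume "x \<in> ?\<Omega>"
        then have "\<bar>g x - f x\<bar> \<le> e / (I + 1)" using f(2)[of x] sub by force
        then show "\<bar>h x * (g x - f x)\<bar> \<le> e / (I + 1) * \<bar>h x\<bar>"
          using mult_left_mono[of _ _ "\<bar>h x\<bar>"] by (simp add: abs_mult mult.commute[of "e / (I + 1)"] del: times_divide_eq_left times_divide_eq_right)
      qed
      also have "\<dots> = e / (I + 1) * I" by (simp add: I_def)
      also have "\<dots> \<le> e" using e I by (simp add: field_simps)
      finally show ?thesis .
    qed
    then show "(LINT x:?\<Omega>|lborel. h x * g x) = 0" using field_le_epsilon[of "\<bar>LINT x:?\<Omega>|lborel. h x * g x\<bar>" 0] by simp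
  qed
  have pos: "0 < sine_mode (\<lambda>_. 1) x" if "x \<in> ?\<Omega>" for x
    using that unfolding sine_mode_apply hypercube_def by (intro prod_pos) (auto intro: sin_gt_zero)
  have "h x0 = 0"
  proof (rule ccontr)
    assume nz: "h x0 \<noteq> 0"
    define s where "s = sgn (h x0)"
    have s0: "0 < s * h x0" using nz by (simp add: s_def sgn_if)
    have "continuous_on ?\<Omega> (\<lambda>x. s * h x)" by (intro continuous_intros conth)
    then have "isCont (\<lambda>x. s * h x) x0" using \<Omega> x0 by (simp add: continuous_on_eq_continuous_at)
    then have "((\<lambda>x. s * h x) \<longlongrightarrow> s * h x0) (at x0)" by (rule isContD)
    then have "\<forall>\<^sub>F x in nhds x0. 0 < s * h x"
      using order_tendstoD(1)[OF _ s0] s0 by (auto simp: eventually_nhds_conv_at)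
    then obtain r where r: "0 < r" "\<And>x. dist x x0 < r \<Longrightarrow> 0 < s * h x"
      by (auto simp: eventually_nhds_metric)
    \<comment> \<open>A cone over the ball of radius \<open>r\<close>, with the sign of \<open>h\<close> there.\<close>
    define g where "g x = s * max 0 (r - dist x x0)" for x
    have cg: "continuous_on UNIV g" unfolding g_def by (intro continuous_intros)
    have "h x0 * g x0 = 0"
    proof (rule set_integral_eq_0_imp_eq_0[OF \<Omega> _ g0(1)[OF cg] _ g0(2)[OF cg] x0])
      show "continuous_on ?\<Omega> (\<lambda>x. h x * g x)" by (intro continuous_intros conth continuous_on_subset[OF cg]) auto
      show "0 \<le> h x * g x" for x
      proof (cases "dist x x0 < r")
        case True
        then have "0 \<le> s * h x * (r - dist x x0)" using r(2)[of x] by simp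
        then show ?thesis using True by (simp add: g_def mult_ac)
      qed (simp add: g_def)
    qed
    then show False using s0 r(1) by (auto simp: g_def)
  qed
  then show ?thesis using pos[OF x0] by (simp add: h_def)
qed

section \<open>The multiplicities of the Dirichlet eigenvalues\<close>

text \<open>
  Only frequencies \<open>k\<^sub>i \<ge> 1\<close> count: with a frequency \<open>0\<close> the product of sines is the zero function.
\<close>

definition modes :: "real \<Rightarrow> ('n::finite \<Rightarrow> nat) set"
  where "modes \<mu> = {k. (\<forall>i. 1 \<le> k i) \<and> real (mode_energy k) = \<mu>}"

lemma mode_le_energy: "k i \<le> mode_energy k"
proof -
  have "k i \<le> (k i)\<^sup>2" by (simp add: power2_eq_square)
  also have "\<dots> \<le> mode_energy k" unfolding mode_energy_def by (rule member_le_sum) auto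
  finally show ?thesis .
qed

lemma finite_modes_le: "finite {k :: 'n::finite \<Rightarrow> nat. mode_energy k \<le> N}"
proof (rule finite_subset)
  show "{k :: 'n \<Rightarrow> nat. mode_energy k \<le> N} \<subseteq> PiE UNIV (\<lambda>_. {..N})"
    using mode_le_energy order_trans by (auto simp: PiE_def) blast
qed (intro finite_PiE; simp)

lemma finite_modes: "finite (modes \<mu> :: ('n::finite \<Rightarrow> nat) set)"
  by (rule finite_subset[OF _ finite_modes_le[of "nat \<lfloor>\<mu>\<rfloor>"]]) (auto simp: modes_def)

lemma sum_fun_apply: "(\<Sum>i\<in>I. f i) x = (\<Sum>i\<in>I. f i x)"
  by (induction I rule: infinite_finite_induct) auto

text \<open>
  Subtracting from \<open>u\<close> its components along the finitely many modes of energy \<open>\<mu>\<close> leaves a function \<open>w\<close> orthogonal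
  to these modes; \<open>u\<close> itself and the subtracted modes are orthogonal to all the others. So \<open>w\<close> has no sine coefficient left and
  vanishes by completeness.
\<close>

lemma eigenfunction_in_span_modes:
  fixes u :: "real^'n::finite \<Rightarrow> real"
  assumes u: "u \<in> dirichlet_eigenspace hypercube \<mu>"
  shows "u \<in> span (cube_mode ` modes \<mu>)"
proof -
  let ?\<Omega> = "hypercube :: (real^'n) set"
  have \<Omega>: "open ?\<Omega>" by (rule open_hypercube)
  have uH: "u \<in> H10 ?\<Omega>" and uout: "\<And>x. x \<notin> ?\<Omega> \<Longrightarrow> u x = 0" using u by (auto simp: dirichlet_eigenspace_def)
  have mH: "cube_mode k \<in> H10 ?\<Omega>" if "k \<in> modes \<mu>" for k using that by (intro cube_mode_H10) (auto simp: modes_def)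
  let ?ip = "\<lambda>f g. LINT x:?\<Omega>|lborel. f x * g x"
  define c where "c k = ?ip u (cube_mode k) / ?ip (cube_mode k) (cube_mode k)" for k
  define w where "w x = u x - (\<Sum>k\<in>modes \<mu>. c k * cube_mode k x)" for x
  have H1int: "continuous_on ?\<Omega> f" "set_integrable lborel ?\<Omega> f" if f: "f \<in> H10 ?\<Omega>" for f
  proof -
    show cf: "continuous_on ?\<Omega> f" using C1_on_continuous_on[OF H10_integrable(1)[OF f]] .
    have "set_integrable lborel closed_hypercube (\<lambda>x :: real^'n. 1 :: real)"
      unfolding set_integrable_def by (intro borel_integrable_compact compact_closed_hypercube) auto
    then have one: "set_integrable lborel ?\<Omega> (\<lambda>x. 1 :: real)"
      by (rule set_integrable_subset) (use \<Omega> in \<open>auto simp: hypercube_def less_imp_le\<close>)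
    have "\<bar>f x\<bar> \<le> 1 + f x * f x" for x
      using zero_le_power2[of "\<bar>f x\<bar> - 1"] by (simp add: power2_eq_square algebra_simps)
    then show "set_integrable lborel ?\<Omega> f"
      by (intro set_integrable_continuous_bound[OF \<Omega> cf set_integral_add(1)[OF one product_integrable[OF \<Omega> f f]]])
  qed
  have orth: "(LINT x:?\<Omega>|lborel. w x * sine_mode l x) = 0" for l
  proof (cases "\<forall>i. 1 \<le> l i")
    case False
    then obtain i where "l i = 0" by (auto simp: not_le)
    then have "\<exists>j. sin (real (l j) * x $ j) = 0" for x by (intro exI[of _ i]) simp
    then have "sine_mode l x = 0" for x by (simp add: sine_mode_apply)
    then show ?thesis by (simp add: set_lebesgue_integral_def)
  next
    case True
    then have lH: "cube_mode l \<in> H10 ?\<Omega>" by (intro cube_mode_H10) auto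
    have ints: "set_integrable lborel ?\<Omega> (\<lambda>x. c k * (cube_mode k x * cube_mode l x))" if "k \<in> modes \<mu>" for k
      by (intro set_integrable_mult_right product_integrable \<Omega> mH that lH)
    then have int_sum: "set_integrable lborel ?\<Omega> (\<lambda>x. \<Sum>k\<in>modes \<mu>. c k * (cube_mode k x * cube_mode l x))"
      by (rule set_integrable_sum)
    have sum_int: "(LINT x:?\<Omega>|lborel. \<Sum>k\<in>modes \<mu>. c k * (cube_mode k x * cube_mode l x))
        = (\<Sum>k\<in>modes \<mu>. c k * ?ip (cube_mode k) (cube_mode l))"
      using set_integral_sum[of "modes \<mu>" lborel ?\<Omega> "\<lambda>k x. c k * (cube_mode k x * cube_mode l x)"] ints by simp
    have "(LINT x:?\<Omega>|lborel. w x * sine_mode l x)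
        = (LINT x:?\<Omega>|lborel. u x * cube_mode l x - (\<Sum>k\<in>modes \<mu>. c k * (cube_mode k x * cube_mode l x)))"
      using \<Omega> by (intro set_lebesgue_integral_cong)
        (auto simp: w_def cube_mode_def left_diff_distrib sum_distrib_right mult.assoc)
    also have "\<dots> = ?ip u (cube_mode l) - (\<Sum>k\<in>modes \<mu>. c k * ?ip (cube_mode k) (cube_mode l))"
      using set_integral_diff(2)[OF product_integrable[OF \<Omega> uH lH] int_sum] sum_int by simp
    also have "\<dots> = 0"
    proof (cases "l \<in> modes \<mu>")
      case False
      then have "?ip u (cube_mode l) = 0"
        using True by (intro eigenfunction_orthogonal_cube_mode[OF u]) (auto simp: modes_def)
      moreover have "?ip (cube_mode k) (cube_mode l) = 0" if "k \<in> modes \<mu>" for k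
        using that False True by (intro cube_mode_orthogonal) (auto simp: modes_def)
      ultimately show ?thesis by simp
    next
      case l: True
      have "?ip (cube_mode k) (cube_mode l) = 0" if "k \<in> modes \<mu> - {l}" for k
        using that True by (intro cube_mode_orthogonal) (auto simp: modes_def)
      then have "(\<Sum>k\<in>modes \<mu>. c k * ?ip (cube_mode k) (cube_mode l)) = c l * ?ip (cube_mode l) (cube_mode l)"
        by (subst sum.remove[OF finite_modes l]) simp
      then show ?thesis using cube_mode_norm_pos[of l] True by (simp add: c_def)
    qed
    finally show ?thesis .
  qed
  have "w x = 0" for x
  proof (cases "x \<in> ?\<Omega>")
    case True
    show ?thesis
    proof (rule sine_modes_complete[OF _ _ orth True])
      show "continuous_on ?\<Omega> w" unfolding w_def by (intro continuous_intros H1int(1) uH mH)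
      show "set_integrable lborel ?\<Omega> w" unfolding w_def
        by (intro set_integral_diff(1) set_integrable_sum set_integrable_mult_right H1int(2) uH mH)
    qed
  qed (simp add: w_def uout cube_mode_def)
  then have "u = (\<Sum>k\<in>modes \<mu>. c k *\<^sub>R cube_mode k)"
    by (simp add: fun_eq_iff sum_fun_apply scaleR_fun_def w_def)
  then show ?thesis by (simp add: span_sum span_scale span_base)
qed

lemma cube_mode_inj_on: "inj_on cube_mode {k. \<forall>i. 1 \<le> k i}"
proof (rule inj_onI, rule ccontr)
  fix k l :: "'a \<Rightarrow> nat"
  assume *: "k \<in> {k. \<forall>i. 1 \<le> k i}" "l \<in> {k. \<forall>i. 1 \<le> k i}" "cube_mode k = cube_mode l" "k \<noteq> l"
  then show False using cube_mode_orthogonal[of k l] cube_mode_norm_pos[of l] by simp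
qed

lemma dim_dirichlet_eigenspace_hypercube:
  "dim (dirichlet_eigenspace (hypercube :: (real^'n::finite) set) \<mu>) = card (modes \<mu> :: ('n \<Rightarrow> nat) set)"
proof -
  let ?M = "modes \<mu> :: ('n \<Rightarrow> nat) set" and ?E = "dirichlet_eigenspace (hypercube :: (real^'n) set) \<mu>"
  let ?\<Omega> = "hypercube :: (real^'n) set"
  have M: "1 \<le> k i" if "k \<in> ?M" for k i using that by (auto simp: modes_def)
  have inj: "inj_on cube_mode ?M" by (rule inj_on_subset[OF cube_mode_inj_on]) (use M in auto)
  have "cube_mode ` ?M \<subseteq> ?E" using cube_mode_eigenfunction by (auto simp: modes_def)
  moreover have "?E \<subseteq> span (cube_mode ` ?M)" using eigenfunction_in_span_modes by auto
  ultimately have "span (cube_mode ` ?M) = span ?E" by (metis span_eq span_mono span_superset subset_trans)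
  moreover have "independent (cube_mode ` ?M)"
  proof (rule independent_if_scalars_zero)
    show "finite (cube_mode ` ?M)" by (intro finite_imageI finite_modes)
    fix a v assume s: "(\<Sum>v\<in>cube_mode ` ?M. a v *\<^sub>R v) = 0" and v: "v \<in> cube_mode ` ?M"
    then obtain l where l: "l \<in> ?M" "v = cube_mode l" by auto
    define b where "b k = a (cube_mode k)" for k :: "'n \<Rightarrow> nat"
    have s': "(\<Sum>k\<in>?M. b k * cube_mode k x) = 0" for x
      using fun_cong[OF s, of x] inj by (simp add: sum.reindex sum_fun_apply scaleR_fun_def b_def)
    have "0 = (LINT x:?\<Omega>|lborel. (\<Sum>k\<in>?M. b k * cube_mode k x) * cube_mode l x)"
      by (simp add: s' set_lebesgue_integral_def)
    also have "\<dots> = (LINT x:?\<Omega>|lborel. \<Sum>k\<in>?M. b k * (cube_mode k x * cube_mode l x))"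
      by (simp add: sum_distrib_right mult.assoc)
    also have "\<dots> = (\<Sum>k\<in>?M. b k * (LINT x:?\<Omega>|lborel. cube_mode k x * cube_mode l x))"
      using M l(1)
      by (subst set_integral_sum) (auto intro!: set_integrable_mult_right product_integrable open_hypercube cube_mode_H10)
    also have "\<dots> = b l * (LINT x:?\<Omega>|lborel. cube_mode l x * cube_mode l x)"
      using M l(1) cube_mode_orthogonal[of _ l] by (subst sum.remove[OF finite_modes l(1)]) (auto intro!: sum.neutral)
    finally show "a v = 0" using cube_mode_norm_pos[of l] M l by (simp add: b_def)
  qed
  ultimately have "dim ?E = card (cube_mode ` ?M)" by (rule dim_eq_card)
  then show ?thesis by (simp add: card_image[OF inj])
qed

section \<open>The eigenvalue listing and its indices\<close>

text \<open>
  With \<open>T j\<close> the sum of the multiplicities of the values below \<open>j\<close>, the \<open>m\<close>-th entry of the listing is the least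
  \<open>j\<close> with \<open>m \<le> T (j + 1)\<close>, and the value \<open>j\<close> is taken exactly on the block from \<open>T j + 1\<close> to \<open>T (j + 1)\<close>.
\<close>

lemma monotone_listing_exists:
  fixes d :: "nat \<Rightarrow> nat"
  assumes unbounded: "\<And>m. \<exists>j. m \<le> (\<Sum>i<j. d i)"
  obtains l :: "nat \<Rightarrow> nat" where "mono l"
    and "\<And>j. finite {k. 1 \<le> k \<and> l k = j}" and "\<And>j. card {k. 1 \<le> k \<and> l k = j} = d j"
proof -
  define T where "T j = (\<Sum>i<j. d i)" for j
  define l where "l m = (LEAST j. m \<le> T (Suc j))" for m
  have T: "mono T" unfolding T_def by (intro monoI sum_mono2) auto
  have ex: "\<exists>j. m \<le> T (Suc j)" for m
  proof -
    obtain j where "m \<le> T j" using unbounded[of m] by (auto simp: T_def)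
    then show ?thesis using monoD[OF T, of j "Suc j"] by (intro exI[of _ j]) simp
  qed
  have l: "l m \<le> j \<longleftrightarrow> m \<le> T (Suc j)" for m j
  proof
    assume "l m \<le> j"
    moreover have "m \<le> T (Suc (l m))" unfolding l_def by (rule LeastI_ex[OF ex])
    ultimately show "m \<le> T (Suc j)" using monoD[OF T, of "Suc (l m)" "Suc j"] by simp
  qed (auto simp: l_def intro: Least_le)
  have "{k. 1 \<le> k \<and> l k = j} = {T j<..T (Suc j)}" for j
  proof (cases j)
    case 0
    have e: "l k = 0 \<longleftrightarrow> k \<le> T (Suc 0)" for k using l[of k 0] by simp
    have "T 0 = 0" by (simp add: T_def)
    then show ?thesis by (simp only: 0 e) auto
  next
    case (Suc i)
    have e: "l k = Suc i \<longleftrightarrow> k \<le> T (Suc (Suc i)) \<and> \<not> k \<le> T (Suc i)" for k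
      unfolding l[symmetric] by linarith
    show ?thesis by (simp only: Suc e) auto
  qed
  moreover have "card {T j<..T (Suc j)} = d j" for j by (simp add: T_def)
  moreover have "mono l"
  proof (rule monoI)
    fix m k :: nat assume "m \<le> k"
    also have "k \<le> T (Suc (l k))" using l[of k "l k"] by simp
    finally show "l m \<le> l k" by (simp only: l)
  qed
  ultimately show ?thesis using that[of l] by (simp only: finite_greaterThanAtMost)
qed

lemma sum_card_modes:
  "(\<Sum>j<N. card (modes (real j) :: ('n::finite \<Rightarrow> nat) set)) = card {k :: 'n \<Rightarrow> nat. (\<forall>i. 1 \<le> k i) \<and> mode_energy k < N}"
proof -
  have "{k :: 'n \<Rightarrow> nat. (\<forall>i. 1 \<le> k i) \<and> mode_energy k < N} = (\<Union>j\<in>{..<N}. modes (real j))"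
    by (auto simp: modes_def)
  moreover have "modes (real i) \<inter> modes (real j) = ({} :: ('n \<Rightarrow> nat) set)" if "i \<noteq> j" for i j
    using that by (auto simp: modes_def)
  ultimately show ?thesis by (simp add: card_UN_disjoint finite_modes)
qed

text \<open>
  The eigenvalues are natural numbers with finite multiplicities, and the constant frequencies \<open>k\<^sub>i = a\<close>
  provide infinitely many; so a listing exists, and the chosen one is a listing.
\<close>

lemma hypercube_eigenvalue_listing:
  "eigenvalue_listing (hypercube :: (real^'n::finite) set) (dirichlet_eigenvalue (hypercube :: (real^'n) set))"
proof -
  have "\<exists>j. m \<le> (\<Sum>i<j. card (modes (real i) :: ('n \<Rightarrow> nat) set))" for m
  proof -
    \<comment> \<open>The \<open>m\<close> constant frequencies \<open>1, \<dots>, m\<close> have energies at most \<open>n m\<^sup>2\<close>.\<close>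
    let ?j = "Suc (CARD('n) * m\<^sup>2)" and ?c = "\<lambda>a (i::'n). a :: nat"
    have "CARD('n) * a\<^sup>2 < ?j" if "a \<le> m" for a using that by (simp add: less_Suc_eq_le)
    then have "?c ` {1..m} \<subseteq> {k. (\<forall>i. 1 \<le> k i) \<and> mode_energy k < ?j}" by (auto simp: mode_energy_def)
    moreover have "finite {k :: 'n \<Rightarrow> nat. (\<forall>i. 1 \<le> k i) \<and> mode_energy k < ?j}"
      by (rule finite_subset[OF _ finite_modes_le[of ?j]]) auto
    moreover have "inj_on ?c {1..m}" by (auto simp: inj_on_def fun_eq_iff)
    ultimately have "card {1..m} \<le> card {k :: 'n \<Rightarrow> nat. (\<forall>i. 1 \<le> k i) \<and> mode_energy k < ?j}"
      by (intro card_inj_on_le)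
    then have "m \<le> card {k :: 'n \<Rightarrow> nat. (\<forall>i. 1 \<le> k i) \<and> mode_energy k < ?j}" by simp
    then show ?thesis by (auto simp: sum_card_modes)
  qed
  then obtain l :: "nat \<Rightarrow> nat" where l: "mono l" "\<And>j. finite {k. 1 \<le> k \<and> l k = j}"
    "\<And>j. card {k. 1 \<le> k \<and> l k = j} = card (modes (real j) :: ('n \<Rightarrow> nat) set)"
    by (rule monotone_listing_exists) blast
  have "finite {k. 1 \<le> k \<and> real (l k) = \<mu>} \<and> card {k. 1 \<le> k \<and> real (l k) = \<mu>} = card (modes \<mu> :: ('n \<Rightarrow> nat) set)" for \<mu>
  proof (cases "\<mu> \<in> range real")
    case True
    then show ?thesis using l by auto
  next
    case False
    then have "{k. 1 \<le> k \<and> real (l k) = \<mu>} = {}" "(modes \<mu> :: ('n \<Rightarrow> nat) set) = {}" by (auto simp: modes_def)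
    then show ?thesis by (simp only: card.empty finite.emptyI)
  qed
  then have "eigenvalue_listing (hypercube :: (real^'n) set) (\<lambda>k. real (l k))"
    using l(1) by (auto simp: eigenvalue_listing_def dim_dirichlet_eigenspace_hypercube monotone_on_def)
  then show ?thesis unfolding dirichlet_eigenvalue_def by (rule someI[of "eigenvalue_listing hypercube"])
qed

text \<open>
  Monotonicity places every index before the first occurrence of \<open>N\<close> at a smaller eigenvalue, and the total
  multiplicity of the smaller eigenvalues counts the modes of energy below \<open>N\<close>.
\<close>

lemma kappa_hypercube_le:
  assumes "(modes (real N) :: ('n::finite \<Rightarrow> nat) set) \<noteq> {}"
  obtains m where "1 \<le> m" "dirichlet_eigenvalue (hypercube :: (real^'n) set) m = real N"
    and "kappa (hypercube :: (real^'n) set) (real N)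
      \<le> Suc (card {k :: 'n \<Rightarrow> nat. (\<forall>i. 1 \<le> k i) \<and> mode_energy k < N})"
proof -
  define l where "l = dirichlet_eigenvalue (hypercube :: (real^'n) set)"
  have mono: "mono_on {1..} l" and fin: "\<And>\<mu>. finite {k. 1 \<le> k \<and> l k = \<mu>}"
    and card: "\<And>\<mu>. card {k. 1 \<le> k \<and> l k = \<mu>} = card (modes \<mu> :: ('n \<Rightarrow> nat) set)"
    using hypercube_eigenvalue_listing[where 'n='n]
    by (auto simp: eigenvalue_listing_def l_def dim_dirichlet_eigenspace_hypercube)
  have "card {k. 1 \<le> k \<and> l k = real N} \<noteq> 0" unfolding card using assms finite_modes[of "real N", where 'n='n] by simp
  then have "{k. 1 \<le> k \<and> l k = real N} \<noteq> {}" by (metis card.empty)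
  then have ex: "\<exists>k. 1 \<le> k \<and> l k = real N" by blast
  define m where "m = (LEAST k. 1 \<le> k \<and> l k = real N)"
  have m: "1 \<le> m" "l m = real N" using LeastI_ex[OF ex] by (auto simp: m_def)
  have "{1..<m} \<subseteq> (\<Union>j\<in>{..<N}. {k. 1 \<le> k \<and> l k = real j})"
  proof
    fix k assume k: "k \<in> {1..<m}"
    then have "l k \<le> real N" using monotone_onD[OF mono, of k m] m by auto
    moreover have "l k \<noteq> real N" using k not_less_Least[of k "\<lambda>k. 1 \<le> k \<and> l k = real N"] by (auto simp: m_def)
    moreover have "card {k'. 1 \<le> k' \<and> l k' = l k} \<noteq> 0" using fin k by (auto simp: card_eq_0_iff)
    then have "(modes (l k) :: ('n \<Rightarrow> nat) set) \<noteq> {}" unfolding card by (metis card.empty)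
    then have "\<exists>j :: nat. l k = real j" by (auto simp: modes_def intro: sym)
    then obtain j :: nat where "l k = real j" ..
    ultimately show "k \<in> (\<Union>j\<in>{..<N}. {k. 1 \<le> k \<and> l k = real j})" using k by auto
  qed
  then have "card {1..<m} \<le> card (\<Union>j\<in>{..<N}. {k. 1 \<le> k \<and> l k = real j})"
    by (intro card_mono) (use fin in auto)
  also have "\<dots> \<le> (\<Sum>j<N. card {k. 1 \<le> k \<and> l k = real j})" by (rule card_UN_le) simp
  also have "\<dots> = card {k :: 'n \<Rightarrow> nat. (\<forall>i. 1 \<le> k i) \<and> mode_energy k < N}"
    unfolding card by (rule sum_card_modes)
  finally have "kappa (hypercube :: (real^'n) set) (real N) \<le> Suc (card {k :: 'n \<Rightarrow> nat. (\<forall>i. 1 \<le> k i) \<and> mode_energy k < N})"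
    by (simp add: kappa_def m_def l_def)
  then show ?thesis using that m by (simp add: l_def)
qed

text \<open>
  A frequency \<open>3\<close> costs \<open>8\<close> units above the ground energy \<open>n\<close>, and a frequency \<open>2\<close> costs \<open>3\<close> units. Below \<open>n + 8\<close>
  there remain the modes with frequency \<open>2\<close> on a set of at most two coordinates.
\<close>

lemma card_modes_below:
  "card {k :: 'n::finite \<Rightarrow> nat. (\<forall>i. 1 \<le> k i) \<and> mode_energy k < CARD('n) + 8} \<le> 1 + CARD('n) + (CARD('n) choose 2)"
proof -
  let ?f = "\<lambda>S (i::'n). if i \<in> S then 2 else 1 :: nat"
  have "{k :: 'n \<Rightarrow> nat. (\<forall>i. 1 \<le> k i) \<and> mode_energy k < CARD('n) + 8} \<subseteq> ?f ` (\<Union>j\<in>{..2}. {S. S \<subseteq> UNIV \<and> card S = j})"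
  proof clarify
    fix k :: "'n \<Rightarrow> nat" assume k: "\<forall>i. 1 \<le> k i" and E: "mode_energy k < CARD('n) + 8"
    have k3: "k i < 3" for i
    proof (rule ccontr)
      assume "\<not> k i < 3"
      then have "3\<^sup>2 \<le> (k i)\<^sup>2" by (intro power_mono) auto
      moreover have "(\<Sum>j\<in>UNIV - {i}. 1) \<le> (\<Sum>j\<in>UNIV - {i}. (k j)\<^sup>2)" using k by (intro sum_mono) auto
      moreover have "mode_energy k = (k i)\<^sup>2 + (\<Sum>j\<in>UNIV - {i}. (k j)\<^sup>2)"
        unfolding mode_energy_def by (subst sum.remove[of _ i]) auto
      ultimately have "9 + (CARD('n) - 1) \<le> mode_energy k" by (simp add: card_Diff_singleton)
      then show False using E by simp
    qed
    have k12: "k i = 1 \<or> k i = 2" for i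
    proof -
      from k3[of i] k[rule_format, of i] show ?thesis by linarith
    qed
    define S where "S = {i. k i = 2}"
    have kS: "k = ?f S" using k12 by (force simp: S_def)
    have "mode_energy k = (\<Sum>i\<in>UNIV. 1 + 3 * (if i \<in> S then 1 else 0))"
      unfolding mode_energy_def kS by (intro sum.cong) auto
    also have "\<dots> = CARD('n) + 3 * card S" 
      by (simp only: sum.distrib sum_distrib_left[symmetric]) (simp add: sum.If_cases)
    finally have "card S \<le> 2" using E by simp
    then show "k \<in> ?f ` (\<Union>j\<in>{..2}. {S. S \<subseteq> UNIV \<and> card S = j})" using kS by auto
  qed
  then have "card {k :: 'n \<Rightarrow> nat. (\<forall>i. 1 \<le> k i) \<and> mode_energy k < CARD('n) + 8} \<le> card (?f ` (\<Union>j\<in>{..2}. {S. S \<subseteq> UNIV \<and> card S = j}))"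
    by (intro card_mono) auto
  also have "\<dots> \<le> card (\<Union>j\<in>{..2}. {S :: 'n set. S \<subseteq> UNIV \<and> card S = j})" by (intro card_image_le) auto
  also have "\<dots> \<le> (\<Sum>j\<le>2. card {S :: 'n set. S \<subseteq> UNIV \<and> card S = j})" by (intro card_UN_le) simp
  also have "\<dots> = (\<Sum>j\<le>2. CARD('n) choose j)" by (intro sum.cong refl n_subsets) simp
  also have "\<dots> = 1 + CARD('n) + (CARD('n) choose 2)" by (simp add: numeral_2_eq_2)
  finally show ?thesis .
qed

text \<open>
  The left-hand side collects the first three terms of \<open>\<Sum>k\<le>n. n choose k = 2\<^sup>n\<close>; the next term is positive.
\<close>

lemma quadratic_choose_less_power2:
  assumes "3 \<le> n"
  shows "1 + n + (n choose 2) < 2 ^ n"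
proof -
  have "(\<Sum>k\<in>{..3}. n choose k) \<le> (\<Sum>k\<le>n. n choose k)" using assms by (intro sum_mono2) auto
  also have "\<dots> = 2 ^ n" by (rule choose_row_sum)
  finally have "1 + n + (n choose 2) + (n choose 3) \<le> 2 ^ n" by (simp add: numeral_2_eq_2 numeral_3_eq_3)
  moreover have "0 < n choose 3" using assms by (rule zero_less_binomial)
  ultimately show ?thesis by linarith
qed

section \<open>A quadric that cuts the corners off the cube\<close>

text \<open>
  In the variables \<open>c\<^sub>i = cos x\<^sub>i\<close> this is \<open>\<Sum>i. c\<^sub>i\<^sup>2 - (n - 1)\<close>, which is positive exactly outside the sphere of
  radius \<open>sqrt (n - 1)\<close>. It is the smallest radius that isolates the corners from each other: the sphere passes through the midpoint of
  every edge of \<open>[-1, 1]\<^sup>n\<close>.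
\<close>

definition corner_form :: "real^'n::finite \<Rightarrow> real"
  where "corner_form x = 1 - (\<Sum>i\<in>UNIV. (sin (x $ i))\<^sup>2)"

definition corner_function :: "real^'n::finite \<Rightarrow> real"
  where "corner_function x = cube_mode (\<lambda>_. 1) x * corner_form x"

lemma sin_triple: "sin (3 * t) = 3 * sin t - 4 * sin t ^ 3" for t :: real
proof -
  have "sin (3 * t) = sin (2 * t + t)" by simp
  also have "\<dots> = 2 * sin t * (cos t)\<^sup>2 + (1 - 2 * (sin t)\<^sup>2) * sin t"
    by (simp only: sin_add sin_double cos_double_sin) (simp add: power2_eq_square)
  also have "\<dots> = 3 * sin t - 4 * sin t ^ 3"
    unfolding cos_squared_eq by (simp add: power2_eq_square power3_eq_cube algebra_simps)
  finally show ?thesis .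
qed

lemma mode_energy_single_three: "mode_energy ((\<lambda>_ :: 'n::finite. 1)(i := 3)) = CARD('n) + 8"
proof -
  have "mode_energy ((\<lambda>_ :: 'n. 1)(i := 3)) = 3\<^sup>2 + (\<Sum>j\<in>UNIV - {i}. 1)"
    unfolding mode_energy_def by (subst sum.remove[of _ i]) auto
  also have "(\<Sum>j\<in>UNIV - {i}. 1) = CARD('n) - 1" by (simp add: card_Diff_singleton)
  also have "3\<^sup>2 + (CARD('n) - 1) = CARD('n) + 8" using zero_less_card_finite[where 'a='n] by simp
  finally show ?thesis .
qed

text \<open>
  From \<open>sin\<^sup>3 t = (3 sin t - sin 3t) / 4\<close>, the ground state times \<open>sin\<^sup>2 x\<^sub>i\<close> is a combination of the ground
  state and the mode with frequency \<open>3\<close> in the coordinate \<open>i\<close>.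
\<close>

lemma corner_function_combination:
  "corner_function \<in> eigenfunction_combinations (hypercube :: (real^'n::finite) set) (real (CARD('n) + 8))"
proof -
  let ?one = "\<lambda>_ :: 'n. 1 :: nat"
  let ?E = "\<Union>\<mu>\<in>{..real (CARD('n) + 8)}. dirichlet_eigenspace (hypercube :: (real^'n) set) \<mu>"
  have e1: "mode_energy ?one = CARD('n)" by (simp add: mode_energy_def)
  note e3 = mode_energy_single_three
  have "cube_mode ?one \<in> ?E"
    using cube_mode_eigenfunction[of ?one] e1 by (intro UN_I[of "real (CARD('n))"]) auto
  then have s1: "cube_mode ?one \<in> span ?E" by (rule span_base)
  have "cube_mode (?one(i := 3)) \<in> ?E" for i
    using cube_mode_eigenfunction[of "?one(i := 3)"] e3[of i] by (intro UN_I[of "real (CARD('n) + 8)"]) auto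
  then have s3: "cube_mode (?one(i := 3)) \<in> span ?E" for i by (rule span_base)
  have "cube_mode ?one x * (sin (x $ i))\<^sup>2 = (3/4) * cube_mode ?one x - (1/4) * cube_mode (?one(i := 3)) x" for x i
  proof -
    let ?p = "\<Prod>j\<in>UNIV - {i}. sin (real 1 * x $ j)"
    have a: "sine_mode ?one x = sin (x $ i) * ?p" using sine_mode_upd[of ?one i 1 x] by (simp add: fun_upd_idem)
    have b: "sine_mode (?one(i := 3)) x = (3 * sin (x $ i) - 4 * sin (x $ i) ^ 3) * ?p"
      using sine_mode_upd[of ?one i 3 x] by (simp add: sin_triple)
    show ?thesis unfolding cube_mode_def a b by (simp add: power2_eq_square power3_eq_cube algebra_simps)
  qed
  then have "corner_function = cube_mode ?one - (\<Sum>i\<in>UNIV. (3/4) *\<^sub>R cube_mode ?one - (1/4) *\<^sub>R cube_mode (?one(i := 3)))"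
    by (simp add: fun_eq_iff corner_function_def corner_form_def sum_fun_apply scaleR_fun_def right_diff_distrib sum_distrib_left)
  moreover have "cube_mode ?one - (\<Sum>i\<in>UNIV. (3/4) *\<^sub>R cube_mode ?one - (1/4) *\<^sub>R cube_mode (?one(i := 3))) \<in> span ?E"
    by (intro span_diff span_sum span_scale s1 s3)
  ultimately show ?thesis unfolding eigenfunction_combinations_def by (simp only:)
qed

lemma connected_zero:
  fixes f :: "'a::topological_space \<Rightarrow> real"
  assumes "connected C" "continuous_on C f" "a \<in> C" "b \<in> C" "f a < 0" "0 < f b"
  obtains z where "z \<in> C" "f z = 0"
proof -
  have "connected (f ` C)" by (rule connected_continuous_image[OF assms(2,1)])
  from connected_ivt_component[OF this, of "f a" "f b" 1 0] show ?thesis using assms that by auto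
qed

text \<open>
  The closure in the definition of the nodal set adds only boundary points of the cube.
\<close>

lemma hypercube_minus_nodal_set:
  "hypercube - nodal_set hypercube corner_function = {x :: real^'n::finite. x \<in> hypercube \<and> corner_form x \<noteq> 0}"
proof -
  have "0 < cube_mode (\<lambda>_. 1) x" if "x \<in> hypercube" for x :: "real^'n"
    using that unfolding cube_mode_def sine_mode_apply
    by (auto simp: hypercube_def intro!: prod_pos sin_gt_zero)
  then have eq: "{x :: real^'n. x \<in> hypercube \<and> corner_function x = 0} = {x. x \<in> hypercube \<and> corner_form x = 0}"
    by (auto simp: corner_function_def) force
  have "closed {x :: real^'n. corner_form x = 0}"
    unfolding corner_form_def by (intro closed_Collect_eq continuous_intros)
  then have "closure {x :: real^'n. x \<in> hypercube \<and> corner_form x = 0} \<subseteq> {x. corner_form x = 0}"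
    by (intro closure_minimal) auto
  moreover have "{x :: real^'n. x \<in> hypercube \<and> corner_form x = 0} \<subseteq> closure {x. x \<in> hypercube \<and> corner_form x = 0}"
    by (rule closure_subset)
  ultimately show ?thesis unfolding nodal_set_def eq by auto
qed

text \<open>
  The centre and one point near each corner lie in different components. The quadratic form is negative at
  the centre and positive near the corners. Points near two corners lie on different sides of some hyperplane
  \<open>x\<^sub>i = \<pi> / 2\<close>; a connected set containing both meets this hyperplane, where \<open>sin\<^sup>2 x\<^sub>i = 1\<close> forces the form to
  be at most \<open>0\<close>.
\<close>

lemma corner_function_nodal_domains:
  assumes n: "2 \<le> CARD('n::finite)"
  shows "enat (2 ^ CARD('n) + 1) \<le> nodal_domain_count (hypercube :: (real^'n) set) corner_function"
proof -
  let ?D = "{x :: real^'n. x \<in> hypercube \<and> corner_form x \<noteq> 0}"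
  \<comment> \<open>The distance of the sample points from the faces: small enough for \<open>n sin\<^sup>2 t < 1\<close>.\<close>
  define t where "t = 1 / (real (CARD('n)) + 1)"
  have t: "0 < t" "t < pi / 2"
  proof -
    show "0 < t" by (simp add: t_def)
    have "t \<le> 1" by (simp add: t_def)
    then show "t < pi / 2" using pi_gt3 by linarith
  qed
  have nt: "real (CARD('n)) * (sin t)\<^sup>2 < 1"
  proof -
    have "sin t \<le> t" "0 \<le> sin t" using t by (auto intro: sin_x_le_x sin_ge_zero)
    then have "(sin t)\<^sup>2 \<le> t\<^sup>2" by (intro power_mono)
    then have "real (CARD('n)) * (sin t)\<^sup>2 \<le> real (CARD('n)) * t\<^sup>2" by (intro mult_left_mono) auto
    also have "\<dots> = (real (CARD('n)) * t) * t" by (simp add: power2_eq_square)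
    also have "\<dots> < 1 * 1" using t by (intro mult_strict_mono) (auto simp: t_def)
    finally show ?thesis by simp
  qed
  \<comment> \<open>The value \<open>None\<close> stands for the centre, and \<open>Some S\<close> for the corner whose coordinates in \<open>S\<close> are near \<open>\<pi>\<close>.\<close>
  define p :: "'n set option \<Rightarrow> real^'n" where
    "p a = (case a of None \<Rightarrow> (\<chi> i. pi / 2) | Some S \<Rightarrow> (\<chi> i. if i \<in> S then pi - t else t))" for a
  have center: "corner_form (p None) < 0" using n by (simp add: p_def corner_form_def)
  have corner: "0 < corner_form (p (Some S))" for S
  proof -
    have "(sin (p (Some S) $ i))\<^sup>2 = (sin t)\<^sup>2" for i by (simp add: p_def)
    then show ?thesis using nt by (simp add: corner_form_def)
  qed
  have cf: "continuous_on A corner_form" for A :: "(real^'n) set"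
    unfolding corner_form_def by (intro continuous_intros)
  have "p a \<in> hypercube" for a using t by (cases a) (auto simp: p_def hypercube_def)
  then have pD: "p a \<in> ?D" for a using center corner[of "the a"] by (cases a) auto
  let ?C = "\<lambda>a. connected_component_set ?D (p a)"
  have conn: "connected (?C a)" for a by (rule connected_connected_component)
  have sub: "?C a \<subseteq> ?D" for a by (rule connected_component_subset)
  have self: "p a \<in> ?C a" for a using pD[of a] by (simp add: connected_component_refl)
  have no_sign: False if "x \<in> ?C a" "y \<in> ?C a" "corner_form x < 0" "0 < corner_form y" for x y a
    using connected_zero[OF conn cf that(1-4)] sub by blast
  have no_cross: False if S: "i \<in> S" "i \<notin> T" and same: "?C (Some S) = ?C (Some T)" for i S T
  proof -
    have "p (Some S) \<in> ?C (Some S)" "p (Some T) \<in> ?C (Some S)" using self same by auto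
    moreover have "cos (p (Some S) $ i) < 0" "0 < cos (p (Some T) $ i)"
      using S t cos_gt_zero[of t] by (auto simp: p_def)
    moreover have "continuous_on (?C (Some S)) (\<lambda>x. cos (x $ i))" by (intro continuous_intros)
    ultimately obtain z where z: "z \<in> ?C (Some S)" "cos (z $ i) = 0"
      using connected_zero[OF conn] by blast
    then have "(sin (z $ i))\<^sup>2 = 1" using sin_cos_squared_add[of "z $ i"] by simp
    moreover have "(sin (z $ i))\<^sup>2 \<le> (\<Sum>j\<in>UNIV. (sin (z $ j))\<^sup>2)" by (rule member_le_sum) auto
    ultimately have "corner_form z \<le> 0" by (simp add: corner_form_def)
    moreover have "corner_form z \<noteq> 0" using z(1) sub by blast
    ultimately show False using no_sign[OF z(1) self _ corner] by simp
  qed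
  have no_center: False if same: "?C None = ?C (Some S)" for S
  proof -
    have "p (Some S) \<in> ?C None" unfolding same by (rule self)
    then show False by (rule no_sign[OF self _ center corner])
  qed
  have inj: "inj ?C"
  proof (rule injI)
    fix a b assume ab: "?C a = ?C b"
    show "a = b"
    proof (cases a; cases b)
      fix T assume "a = None" "b = Some T"
      with ab have "?C None = ?C (Some T)" by (simp only:)
      then show ?thesis using no_center by blast
    next
      fix S assume "a = Some S" "b = None"
      with ab have "?C None = ?C (Some S)" by (simp only:)
      then show ?thesis using no_center by blast
    next
      fix S T assume eq: "a = Some S" "b = Some T"
      with ab have same: "?C (Some S) = ?C (Some T)" by (simp only:)
      have "i \<in> S \<longleftrightarrow> i \<in> T" for i
        using no_cross[OF _ _ same, of i] no_cross[OF _ _ same[symmetric], of i] by blast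
      then show ?thesis unfolding eq by blast
    qed simp
  qed
  have "?C ` UNIV \<subseteq> components ?D" using pD by (auto intro: componentsI)
  then have "CARD('n set option) \<le> card (components ?D)" if "finite (components ?D)"
    using card_inj_on_le[OF inj _ that] by simp
  moreover have "CARD('n set option) = 2 ^ CARD('n) + 1"
    by (simp add: card_UNIV_option card_Pow[of "UNIV :: 'n set", simplified])
  ultimately show ?thesis
    by (simp add: nodal_domain_count_def hypercube_minus_nodal_set Let_def)
qed

theorem proposition2p1:
  assumes "CARD('n::finite) \<ge> 3"
  shows "\<not> ECP (hypercube :: (real ^ 'n) set) \<and>
    (\<exists>m\<ge>1. \<exists>v\<in>eigenfunction_combinations (hypercube :: (real ^ 'n) set)
                    (dirichlet_eigenvalue (hypercube :: (real ^ 'n) set) m).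
       nodal_domain_count hypercube v >
         enat (kappa (hypercube :: (real ^ 'n) set)
                 (dirichlet_eigenvalue (hypercube :: (real ^ 'n) set) m)))"
proof -
  let ?\<Omega> = "hypercube :: (real^'n) set" and ?N = "CARD('n) + 8"
  have "(\<lambda>_. 1)(i := 3) \<in> modes (real ?N)" for i :: 'n
    using mode_energy_single_three[of i] by (simp add: modes_def)
  then have "(modes (real ?N) :: ('n \<Rightarrow> nat) set) \<noteq> {}" by blast
  then obtain m where m: "1 \<le> m" "dirichlet_eigenvalue ?\<Omega> m = real ?N"
    and k: "kappa ?\<Omega> (real ?N) \<le> Suc (card {k :: 'n \<Rightarrow> nat. (\<forall>i. 1 \<le> k i) \<and> mode_energy k < ?N})"
    by (rule kappa_hypercube_le)
  have "kappa ?\<Omega> (real ?N) < 2 ^ CARD('n) + 1"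
    using k card_modes_below[where 'n='n] quadratic_choose_less_power2[OF assms] by linarith
  then have "enat (kappa ?\<Omega> (dirichlet_eigenvalue ?\<Omega> m)) < enat (2 ^ CARD('n) + 1)" unfolding m(2) by simp
  also have "\<dots> \<le> nodal_domain_count ?\<Omega> corner_function" using assms by (intro corner_function_nodal_domains) simp
  finally have big: "enat (kappa ?\<Omega> (dirichlet_eigenvalue ?\<Omega> m)) < nodal_domain_count ?\<Omega> corner_function" .
  have comb: "corner_function \<in> eigenfunction_combinations ?\<Omega> (dirichlet_eigenvalue ?\<Omega> m)"
    unfolding m(2) by (rule corner_function_combination)
  have "\<not> ECP ?\<Omega>" unfolding ECP_def using m(1) comb big by (auto simp: not_le[symmetric])
  then show ?thesis using m(1) comb big by blast
qed

end
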